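(* Let $\mathbb U$ be the (complete) Urysohn space, $G$ its isometry group, and $B$ the normal subgroup of all isometries having bounded displacement. For any unbounded isometry $g$ of $\mathbb U$ (i.e. $g\in G\setminus B$), the normal subgroup of $G$ generated by $g$ is all of $G$. In fact, every element of $G$ is the product of eight conjugates of $g$. Hence $G/B$ is a simple group.
   Context: The Urysohn space $\mathbb U$ is the unique (up to isometry) complete separable metric space which is homogeneous (every isometry between finite subsets extends to an isometry of $\mathbb U$ onto itself) and which embeds every finite metric space. Its isometry group $G$ consists of the surjective isometries $\mathbb U\to\mathbb U$. An isometry $g$ is bounded (has bounded displacement) if $\sup_{x\in\mathbb U}d(x,g(x))<\infty$, and unbounded otherwise. *)

theory Defs
  imports
    "HOL-Analysis.Analysis"
    "HOL-Algebra.Bij"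
    "HOL-Algebra.SimpleGroups"
begin

definition normal_closure :: "('a, 'b) monoid_scheme \<Rightarrow> 'a set \<Rightarrow> 'a set"
  where "normal_closure G S = \<Inter>{N. N \<lhd> G \<and> S \<subseteq> N}"

definition conjugates :: "('a, 'b) monoid_scheme \<Rightarrow> 'a \<Rightarrow> 'a set"
  where "conjugates G g =
    {k \<otimes>\<^bsub>G\<^esub> g \<otimes>\<^bsub>G\<^esub> inv\<^bsub>G\<^esub> k | k. k \<in> carrier G}"

text \<open>
  The library locale \<open>simple_group\<close> demands \<open>order G > 1\<close>, where the order of an infinite
  group is \<open>0\<close>, so it only covers finite groups. The following notion covers all groups and
  agrees with the library one on finite groups.
\<close>

definition is_simple_grp :: "('a, 'b) monoid_scheme \<Rightarrow> bool"
  where "is_simple_grp G \<longleftrightarrow>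
    group G \<and> carrier G \<noteq> {\<one>\<^bsub>G\<^esub>} \<and>
    (\<forall>H. H \<lhd> G \<longrightarrow> H = carrier G \<or> H = {\<one>\<^bsub>G\<^esub>})"

lemma is_simple_grp_iff_simple_group:
  assumes "finite (carrier G)"
  shows "is_simple_grp G \<longleftrightarrow> simple_group G"
proof
  assume s: "is_simple_grp G"
  then interpret group G by (simp add: is_simple_grp_def)
  obtain x where "x \<in> carrier G" "x \<noteq> \<one>\<^bsub>G\<^esub>"
    using s one_closed unfolding is_simple_grp_def by auto
  then have "card {x, \<one>\<^bsub>G\<^esub>} \<le> card (carrier G)"
    using assms by (intro card_mono) auto
  then have "order G > 1"
    using \<open>x \<noteq> \<one>\<^bsub>G\<^esub>\<close> by (simp add: order_def)
  with s show "simple_group G"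
    by unfold_locales (auto simp: is_simple_grp_def)
next
  assume "simple_group G"
  then show "is_simple_grp G"
    unfolding is_simple_grp_def
    using simple_group.simple_not_triv simple_group.no_real_normal_subgroup
      simple_group.axioms(1) by blast
qed

text \<open>
  As in \<open>BijGroup\<close>, an isometry of \<open>M\<close> onto itself is represented by the function that is
  undefined outside \<open>M\<close>, which makes the representation unique.
\<close>

definition isometries :: "'a set \<Rightarrow> ('a \<Rightarrow> 'a \<Rightarrow> real) \<Rightarrow> ('a \<Rightarrow> 'a) set"
  where "isometries M d = {f \<in> Bij M. \<forall>x\<in>M. \<forall>y\<in>M. d (f x) (f y) = d x y}"

definition isometry_group :: "'a set \<Rightarrow> ('a \<Rightarrow> 'a \<Rightarrow> real) \<Rightarrow> ('a \<Rightarrow> 'a) monoid"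
  where "isometry_group M d = (BijGroup M)\<lparr>carrier := isometries M d\<rparr>"

definition bounded_isometries :: "'a set \<Rightarrow> ('a \<Rightarrow> 'a \<Rightarrow> real) \<Rightarrow> ('a \<Rightarrow> 'a) set"
  where "bounded_isometries M d =
    {f \<in> isometries M d. bdd_above ((\<lambda>x. d x (f x)) ` M)}"

lemma subgroup_isometries: "subgroup (isometries M d) (BijGroup M)"
proof -
  interpret group "BijGroup M" by (rule group_BijGroup)
  show ?thesis
  proof (rule subgroupI)
    show "isometries M d \<subseteq> carrier (BijGroup M)"
      by (auto simp: isometries_def BijGroup_def)
    have "(\<lambda>x\<in>M. x) \<in> isometries M d"
      by (auto simp: isometries_def id_Bij)
    then show "isometries M d \<noteq> {}" by blast
  next
    fix f assume f: "f \<in> isometries M d"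
    then have fB: "f \<in> Bij M" by (simp add: isometries_def)
    have "d (inv_into M f x) (inv_into M f y) = d x y" if "x \<in> M" "y \<in> M" for x y
    proof -
      have "inv_into M f x \<in> M" "inv_into M f y \<in> M"
        using fB that by (simp_all add: Bij_inv_into_mem)
      then have "d (f (inv_into M f x)) (f (inv_into M f y)) =
          d (inv_into M f x) (inv_into M f y)"
        using f by (simp add: isometries_def)
      moreover have "f (inv_into M f x) = x" "f (inv_into M f y) = y"
        using fB that by (auto simp: Bij_def bij_betw_def f_inv_into_f)
      ultimately show ?thesis by simp
    qed
    then show "inv\<^bsub>BijGroup M\<^esub> f \<in> isometries M d"
      using fB by (simp add: inv_BijGroup isometries_def restrict_inv_into_Bij)
  next
    fix f g assume fg: "f \<in> isometries M d" "g \<in> isometries M d"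
    then have "g x \<in> M" if "x \<in> M" for x
      using that by (auto simp: isometries_def dest: Bij_imp_funcset)
    with fg show "f \<otimes>\<^bsub>BijGroup M\<^esub> g \<in> isometries M d"
      by (auto simp: isometries_def BijGroup_def compose_Bij compose_eq)
  qed
qed

lemma group_isometry_group: "group (isometry_group M d)"
  unfolding isometry_group_def
  by (rule subgroup.subgroup_is_group[OF subgroup_isometries group_BijGroup])

text \<open>
  Every finite metric space is isometric to one whose points are natural numbers, so the
  embedding axiom quantifies over those; see \<open>embeds_finite_any\<close> for arbitrary point types.
\<close>

locale urysohn_space = Metric_space M d
  for M :: "'a set" and d :: "'a \<Rightarrow> 'a \<Rightarrow> real" +
  assumes complete: "mcomplete"
    and separable: "separable_space mtopology"
    and homogeneous:
      "\<And>A B f. \<lbrakk>finite A; A \<subseteq> M; finite B; B \<subseteq> M; f ` A = B;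
          \<forall>x\<in>A. \<forall>y\<in>A. d (f x) (f y) = d x y\<rbrakk>
        \<Longrightarrow> \<exists>h\<in>isometries M d. \<forall>x\<in>A. h x = f x"
    and embeds_finite:
      "\<And>(F :: nat set) e. \<lbrakk>finite F; Metric_space F e\<rbrakk>
        \<Longrightarrow> \<exists>f. f \<in> F \<rightarrow> M \<and> (\<forall>x\<in>F. \<forall>y\<in>F. d (f x) (f y) = e x y)"

lemma (in urysohn_space) embeds_finite_any:
  fixes F :: "'b set"
  assumes "finite F" "Metric_space F e"
  shows "\<exists>f. f \<in> F \<rightarrow> M \<and> (\<forall>x\<in>F. \<forall>y\<in>F. d (f x) (f y) = e x y)"
proof -
  interpret F: Metric_space F e by fact
  obtain t :: "'b \<Rightarrow> nat" where t: "inj_on t F"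
    using assms(1) finite_imp_inj_to_nat_seg by blast
  define s where "s = inv_into F t"
  define e' where "e' i j =
    (if i \<in> t ` F \<and> j \<in> t ` F then e (s i) (s j) else 0)" for i j
  have s: "s (t x) = x" if "x \<in> F" for x
    using that t by (simp add: s_def)
  have "Metric_space (t ` F) e'"
    by unfold_locales (auto simp: e'_def s F.commute F.triangle)
  then obtain f where f: "f \<in> t ` F \<rightarrow> M"
      "\<forall>i\<in>t ` F. \<forall>j\<in>t ` F. d (f i) (f j) = e' i j"
    using embeds_finite[of "t ` F" e'] assms(1) by blast
  show ?thesis
    by (rule exI[of _ "f \<circ> t"]) (use f s in \<open>auto simp: e'_def\<close>)
qed

end

theory Submission
  imports Defs
begin

text \<open>
  The proof is a back-and-forth in the spirit of Tent and Ziegler. Say that \<open>a\<close> and \<open>c\<close> are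
  independent over a finite set \<open>E\<close> if some geodesic from \<open>a\<close> to \<open>c\<close> passes through \<open>E\<close>, i.e.
  \<open>d a c\<close> is as large as the distances to \<open>E\<close> allow. An unbounded isometry \<open>g\<close> moves types
  maximally: every type over \<open>E\<close> has a realisation \<open>a\<close> that is independent from \<open>g a\<close> over \<open>E\<close>.
  Hence \<open>g\<close> can be conjugated, fixing \<open>E\<close> and \<open>g E\<close>, so as to send a finite set to any
  sufficiently independent set of the right type. Given four conjugates of \<open>g\<close>, it follows that
  after enlarging a finite set \<open>X\<close> suitably, the product of the conjugates can be adjusted to
  agree on any finite set with any isometry that it equals on \<open>X\<close>, without changing the
  conjugates on the chain starting at \<open>X\<close>. Playing this off between a product of four
  conjugates of \<open>g\<close> and \<open>h\<close> times a product of four conjugates of the inverse of \<open>g\<close> makes both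
  converge to the same isometry, so \<open>h\<close> is a product of eight conjugates of \<open>g\<close>.
\<close>

subsection \<open>Simplicity of quotients\<close>

text \<open>The preimage \<open>P\<close> in \<open>G\<close> of a normal subgroup \<open>H\<close>
  of the quotient is normal. A nontrivial coset in \<open>H\<close> puts an element outside
  \<open>N\<close> into \<open>P\<close>, and with it the normal closure of that element, which is
  all of \<open>G\<close>.\<close>

lemma is_simple_grp_Mod:
  assumes N: "N \<lhd> G" and ne: "N \<noteq> carrier G"
    and cl: "\<And>g. g \<in> carrier G - N \<Longrightarrow> normal_closure G {g} = carrier G"
  shows "is_simple_grp (G Mod N)"
proof -
  interpret N: normal N G by fact
  have grp: "group (G Mod N)" by (rule N.factorgroup_is_group)
  interpret pi: group_hom G "G Mod N" "\<lambda>a. N #>\<^bsub>G\<^esub> a"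
    by unfold_locales
      (use grp N.r_coset_hom_Mod in \<open>auto simp: group_def group_axioms_def group_hom_axioms_def monoid_def\<close>)
  have one: "\<one>\<^bsub>G Mod N\<^esub> = N" by (simp add: FactGroup_def)
  have coset_N: "N #>\<^bsub>G\<^esub> a = N \<longleftrightarrow> a \<in> N" if "a \<in> carrier G" for a
    using N.coset_join1[OF _ that N.subgroup_axioms] N.rcos_const by blast
  have "carrier (G Mod N) \<noteq> {\<one>\<^bsub>G Mod N\<^esub>}"
  proof -
    obtain a where "a \<in> carrier G" "a \<notin> N" using ne N.subset by blast
    then have "N #>\<^bsub>G\<^esub> a \<in> carrier (G Mod N)" "N #>\<^bsub>G\<^esub> a \<noteq> \<one>\<^bsub>G Mod N\<^esub>"
      unfolding one using coset_N pi.hom_closed by auto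
    then show ?thesis by auto
  qed
  moreover have "H = carrier (G Mod N) \<or> H = {\<one>\<^bsub>G Mod N\<^esub>}" if H: "H \<lhd> G Mod N" for H
  proof (cases "H \<subseteq> {N}")
    case True
    moreover have "N \<in> H" using subgroup.one_closed[OF normal_imp_subgroup[OF H]] one by simp
    ultimately have "H = {N}" by (intro equalityI) simp_all
    then show ?thesis unfolding one by (rule disjI2)
  next
    case False
    interpret H: normal H "G Mod N" by fact
    define P where "P = {a \<in> carrier G. N #>\<^bsub>G\<^esub> a \<in> H}"
    have "subgroup P G"
    proof (rule N.subgroupI)
      show "P \<subseteq> carrier G" by (auto simp: P_def)
      have "\<one>\<^bsub>G\<^esub> \<in> P" unfolding P_def using pi.hom_one H.one_closed by simp
      then show "P \<noteq> {}" by blast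
      fix a b assume a: "a \<in> P" and b: "b \<in> P"
      have ab: "a \<in> carrier G" "b \<in> carrier G" "N #>\<^bsub>G\<^esub> a \<in> H" "N #>\<^bsub>G\<^esub> b \<in> H"
        using a b by (simp_all add: P_def)
      show "inv\<^bsub>G\<^esub> a \<in> P"
        unfolding P_def using pi.hom_inv[OF ab(1)] H.m_inv_closed[OF ab(3)] ab by simp
      show "a \<otimes>\<^bsub>G\<^esub> b \<in> P"
        unfolding P_def using pi.hom_mult[OF ab(1,2)] H.m_closed[OF ab(3,4)] ab by simp
    qed
    then have P: "P \<lhd> G"
      unfolding N.normal_inv_iff
    proof (intro conjI ballI)
      fix k a assume k: "k \<in> carrier G" and "a \<in> P"
      then have a: "a \<in> carrier G" "N #>\<^bsub>G\<^esub> a \<in> H" by (simp_all add: P_def)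
      have "N #>\<^bsub>G\<^esub> (k \<otimes>\<^bsub>G\<^esub> a \<otimes>\<^bsub>G\<^esub> inv\<^bsub>G\<^esub> k) =
          (N #>\<^bsub>G\<^esub> k) \<otimes>\<^bsub>G Mod N\<^esub> (N #>\<^bsub>G\<^esub> a) \<otimes>\<^bsub>G Mod N\<^esub> inv\<^bsub>G Mod N\<^esub> (N #>\<^bsub>G\<^esub> k)"
        using k a pi.hom_mult pi.hom_inv by simp
      then show "k \<otimes>\<^bsub>G\<^esub> a \<otimes>\<^bsub>G\<^esub> inv\<^bsub>G\<^esub> k \<in> P"
        unfolding P_def using k a H.inv_op_closed2[OF pi.hom_closed[OF k] a(2)] by simp
    qed
    obtain K where K: "K \<in> H" "K \<noteq> N" using False by blast
    then have "K \<in> carrier (G Mod N)" using H.subset by blast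
    then obtain g where g: "g \<in> carrier G" "K = N #>\<^bsub>G\<^esub> g"
      by (auto simp: FactGroup_def RCOSETS_def)
    then have "normal_closure G {g} = carrier G" using cl coset_N K by blast
    moreover have "normal_closure G {g} \<subseteq> P"
      using P g K by (auto simp: normal_closure_def P_def)
    ultimately have "carrier G \<subseteq> P" by simp
    then have "carrier (G Mod N) \<subseteq> H"
      by (auto simp: FactGroup_def RCOSETS_def P_def)
    then show ?thesis using H.subset by blast
  qed
  ultimately show ?thesis using grp by (simp add: is_simple_grp_def)
qed

context urysohn_space
begin

subsection \<open>Isometries and one-point extensions\<close>

abbreviation Iso where "Iso \<equiv> isometries M d"
abbreviation mul (infixl "\<star>" 70)
  where "f \<star> g \<equiv> f \<otimes>\<^bsub>isometry_group M d\<^esub> g"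
abbreviation iv where "iv f \<equiv> inv\<^bsub>isometry_group M d\<^esub> f"
abbreviation idm where "idm \<equiv> \<one>\<^bsub>isometry_group M d\<^esub>"

lemma carrier_isometry_group [simp]: "carrier (isometry_group M d) = Iso"
  by (simp add: isometry_group_def)

sublocale isom: group "isometry_group M d"
  rewrites "carrier (isometry_group M d) = Iso"
  by (simp_all add: group_isometry_group)

lemma iso_mul [simp]: "f \<in> Iso \<Longrightarrow> g \<in> Iso \<Longrightarrow> f \<star> g \<in> Iso"
  using isom.m_closed by simp

lemma iso_iv [simp]: "f \<in> Iso \<Longrightarrow> iv f \<in> Iso"
  using isom.inv_closed by simp

lemma iso_id [simp]: "idm \<in> Iso"
  using isom.one_closed by simp

lemma iso_in [simp]: "f \<in> Iso \<Longrightarrow> x \<in> M \<Longrightarrow> f x \<in> M"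
  by (auto simp: isometries_def dest: Bij_imp_funcset)

lemma iso_dist [simp]: "f \<in> Iso \<Longrightarrow> x \<in> M \<Longrightarrow> y \<in> M \<Longrightarrow> d (f x) (f y) = d x y"
  by (auto simp: isometries_def)

lemma iso_image [simp]: "f \<in> Iso \<Longrightarrow> A \<subseteq> M \<Longrightarrow> f ` A \<subseteq> M"
  by auto

lemma mul_app [simp]:
  assumes "f \<in> Iso" "g \<in> Iso" "x \<in> M"
  shows "(f \<star> g) x = f (g x)"
  using assms by (simp add: isometry_group_def isometries_def BijGroup_def compose_eq)

lemma id_app [simp]: "x \<in> M \<Longrightarrow> idm x = x"
  by (simp add: isometry_group_def BijGroup_def)

lemma iv_app1 [simp]:
  assumes "f \<in> Iso" "x \<in> M"
  shows "iv f (f x) = x"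
  using assms mul_app[of "iv f" f x] isom.l_inv[of f] by simp

lemma iv_app2 [simp]:
  assumes "f \<in> Iso" "x \<in> M"
  shows "f (iv f x) = x"
  using assms mul_app[of f "iv f" x] isom.r_inv[of f] by simp

lemma iso_eqI:
  assumes "f \<in> Iso" "g \<in> Iso" "\<And>x. x \<in> M \<Longrightarrow> f x = g x"
  shows "f = g"
  using assms by (auto simp: isometries_def Bij_def intro: extensionalityI)

lemma iso_dist_iv1:
  assumes "f \<in> Iso" "x \<in> M" "y \<in> M"
  shows "d (f x) y = d x (iv f y)"
  using iso_dist[of f x "iv f y"] assms by simp

lemma iso_dist_iv2:
  assumes "f \<in> Iso" "x \<in> M" "y \<in> M"
  shows "d (iv f x) y = d x (f y)"
  using iso_dist[of f "iv f x" y] assms by simp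

text \<open>Preservation of distances makes \<open>R\<close> single-valued, since points at distance
  0 coincide. Giving a finite partial isometry by its graph allows it to be assembled from pieces
  without a separate check on overlaps.\<close>

lemma homogeneous_rel:
  assumes fin: "finite R" and RM: "R \<subseteq> M \<times> M"
    and dist: "\<And>x x' y y'. (x, x') \<in> R \<Longrightarrow> (y, y') \<in> R \<Longrightarrow> d x' y' = d x y"
  obtains h where "h \<in> Iso" "\<And>x x'. (x, x') \<in> R \<Longrightarrow> h x = x'"
proof -
  have fn: "x' = x''" if "(x, x') \<in> R" "(x, x'') \<in> R" for x x' x''
    using dist[OF that] that RM by (metis mem_Sigma_iff subsetD zero)
  define f where "f x = (SOME x'. (x, x') \<in> R)" for x
  have f: "f x = x'" if "(x, x') \<in> R" for x x'
    unfolding f_def using that fn by blast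
  have "\<exists>h\<in>Iso. \<forall>x\<in>fst ` R. h x = f x"
  proof (rule homogeneous[of _ "snd ` R"])
    show "f ` fst ` R = snd ` R" by (force simp: f image_iff)
  qed (use fin RM in \<open>auto simp: f dist\<close>)
  then obtain h where "h \<in> Iso" "\<forall>x\<in>fst ` R. h x = f x" by blast
  then show thesis using that f by (metis fst_conv image_eqI)
qed

lemma M_nonempty: obtains x0 where "x0 \<in> M"
proof -
  have "Metric_space {0::nat} (\<lambda>_ _. 0)" by unfold_locales auto
  then show thesis using embeds_finite[of "{0}" "\<lambda>_ _. 0"] that by auto
qed

text \<open>An abstract point at the distances \<open>f\<close> is adjoined to \<open>X\<close>, the
  resulting finite metric space is embedded, and the embedded copy of \<open>X\<close> is moved back
  onto \<open>X\<close> by homogeneity.\<close>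

lemma katetov_realise_fun:
  assumes fin: "finite X" "X \<subseteq> M"
    and f: "\<And>x y. x \<in> X \<Longrightarrow> y \<in> X \<Longrightarrow> f x \<le> f y + d x y"
    and f': "\<And>x y. x \<in> X \<Longrightarrow> y \<in> X \<Longrightarrow> d x y \<le> f x + f y"
  shows "\<exists>u\<in>M. \<forall>x\<in>X. d u x = f x"
proof (cases "\<exists>x0\<in>X. f x0 = 0")
  \<comment> \<open>A zero of \<open>f\<close> at \<open>x0\<close> forces the new point to coincide
    with \<open>x0\<close>; adjoining a separate point would yield only a pseudometric.\<close>
  case True
  then obtain x0 where x0: "x0 \<in> X" "f x0 = 0" by blast
  have "d x0 x = f x" if "x \<in> X" for x
    using f[OF that x0(1)] f'[OF x0(1) that] x0(2) commute[of x x0] by simp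
  then show ?thesis using x0 fin by blast
next
  case False
  have pos: "f x > 0" if "x \<in> X" for x
    using f'[OF that that] False that fin nonneg[of x x] by force
  \<comment> \<open>\<open>None\<close> is the new point. The absolute values appear because
    \<open>Metric_space\<close> demands nonnegativity also at arguments outside the carrier.\<close>
  define e where "e p q = (case (p, q) of (Some x, Some y) \<Rightarrow> d x y
     | (Some x, None) \<Rightarrow> \<bar>f x\<bar> | (None, Some y) \<Rightarrow> \<bar>f y\<bar> | (None, None) \<Rightarrow> 0)" for p q
  have Me: "Metric_space (insert None (Some ` X)) e"
  proof
    fix p q r assume pq: "p \<in> insert None (Some ` X)" "q \<in> insert None (Some ` X)"
    show "(e p q = 0) = (p = q)"
      using pq
    proof (elim insertE imageE; hypsubst)
      fix x y assume "x \<in> X" "y \<in> X"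
      then show "(e (Some x) (Some y) = 0) = (Some x = Some y)"
        using fin by (simp add: e_def subset_iff)
      show "(e (Some x) None = 0) = (Some x = None)" 
        using pos[OF \<open>x \<in> X\<close>] by (simp add: e_def)
      show "(e None (Some x) = 0) = (None = Some x)" 
        using pos[OF \<open>x \<in> X\<close>] by (simp add: e_def)
    qed (simp add: e_def)
    assume "r \<in> insert None (Some ` X)"
    then show "e p r \<le> e p q + e q r"
      using pq
    proof (elim insertE imageE; hypsubst)
      fix x y z assume "x \<in> X" "y \<in> X" "z \<in> X"
      then show "e (Some x) (Some z) \<le> e (Some x) (Some y) + e (Some y) (Some z)"
        using fin triangle[of x y z] by (auto simp: e_def)
    next
      fix x y assume *: "x \<in> X" "y \<in> X"
      then show "e None (Some x) \<le> e None (Some y) + e (Some y) (Some x)"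
        using f[of x y] pos[of x] pos[of y] commute[of x y] by (simp add: e_def)
      show "e (Some x) None \<le> e (Some x) (Some y) + e (Some y) None"
        using * f[of x y] pos[of x] pos[of y] by (simp add: e_def)
      show "e (Some x) (Some y) \<le> e (Some x) None + e None (Some y)"
        using * f'[of x y] pos[of x] pos[of y] by (simp add: e_def)
    qed (auto simp: e_def)
  qed (auto simp: e_def commute split: option.splits)
  obtain t where t: "t \<in> insert None (Some ` X) \<rightarrow> M"
    "\<And>p q. p \<in> insert None (Some ` X) \<Longrightarrow> q \<in> insert None (Some ` X) \<Longrightarrow> d (t p) (t q) = e p q"
    using embeds_finite_any[OF _ Me] fin by blast
  obtain h where h: "h \<in> Iso" "\<And>x x'. (x, x') \<in> (\<lambda>x. (t (Some x), x)) ` X \<Longrightarrow> h x = x'"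
  proof (rule homogeneous_rel[of "(\<lambda>x. (t (Some x), x)) ` X"])
    show "(\<lambda>x. (t (Some x), x)) ` X \<subseteq> M \<times> M" using t fin by auto
  qed (use fin t in \<open>auto simp: e_def\<close>)
  have tM: "t None \<in> M" "x \<in> X \<Longrightarrow> t (Some x) \<in> M" for x using t(1) by auto
  have "d (h (t None)) x = f x" if "x \<in> X" for x
  proof -
    have "h (t (Some x)) = x" using h(2) that by blast
    then have "d (h (t None)) x = d (t None) (t (Some x))"
      using iso_dist[OF h(1) tM(1) tM(2)[OF that]] by simp
    then show ?thesis using t(2) that pos[OF that] by (simp add: e_def)
  qed
  then show ?thesis using h tM by (intro bexI[of _ "h (t None)"]) auto
qed

text \<open>Two values listed for the same point are equal by \<open>lip\<close>, so the prescribed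
  distances may be given as a relation, from which the function is recovered by choice.\<close>

lemma katetov_realise:
  assumes fin: "finite R" and RM: "fst ` R \<subseteq> M"
    and lip: "\<And>x r y s. (x, r) \<in> R \<Longrightarrow> (y, s) \<in> R \<Longrightarrow> r \<le> s + d x y"
    and tri: "\<And>x r y s. (x, r) \<in> R \<Longrightarrow> (y, s) \<in> R \<Longrightarrow> d x y \<le> r + s"
  obtains u where "u \<in> M" "\<And>x r. (x, r) \<in> R \<Longrightarrow> d u x = r"
proof -
  have fn: "r \<le> s" if "(x, r) \<in> R" "(x, s) \<in> R" for x r s
    using lip[OF that] that RM by force
  define f where "f x = (SOME r. (x, r) \<in> R)" for x
  have f: "f x = r" if "(x, r) \<in> R" for x r
    unfolding f_def by (rule some1_equality) (use that fn in \<open>blast intro: antisym\<close>)+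
  have "\<exists>u\<in>M. \<forall>x\<in>fst ` R. d u x = f x"
    by (rule katetov_realise_fun) (use fin RM lip tri in \<open>auto simp: f\<close>)
  then show thesis using that f by (metis fst_conv image_eqI)
qed

subsection \<open>Independence over finite sets\<close>

definition via :: "'a set \<Rightarrow> 'a \<Rightarrow> 'a \<Rightarrow> bool"
  where "via E a c \<longleftrightarrow> (\<exists>e\<in>E. d a e + d e c \<le> d a c)"

lemma via_sym: "via E a c \<longleftrightarrow> via E c a"
  by (simp add: via_def commute add.commute)

lemma via_mono: "via E a c \<Longrightarrow> E \<subseteq> F \<Longrightarrow> via F a c"
  by (auto simp: via_def)

lemma via_in1: "a \<in> E \<Longrightarrow> a \<in> M \<Longrightarrow> via E a c"
  by (auto simp: via_def intro!: bexI[of _ a])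

text \<open>Transitivity of independence: if a geodesic from \<open>a\<close> to \<open>c\<close>
  meets \<open>b\<close>, and one from \<open>b\<close> to \<open>c\<close> meets \<open>e\<close>,
  then rerouting through \<open>e\<close> costs nothing by the triangle inequality.\<close>

lemma via_trans1:
  assumes "via B a c" "B \<subseteq> M" "E \<subseteq> M" "a \<in> M" "c \<in> M" "\<And>b. b \<in> B \<Longrightarrow> via E b c"
  shows "via E a c"
proof -
  obtain b where b: "b \<in> B" "d a b + d b c \<le> d a c" using assms(1) by (auto simp: via_def)
  obtain e where e: "e \<in> E" "d b e + d e c \<le> d b c" using assms(6)[OF b(1)] by (auto simp: via_def)
  have "d a e \<le> d a b + d b e" by (rule triangle) (use b e assms in auto)
  with b e show ?thesis by (auto simp: via_def intro!: bexI[of _ e])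
qed

lemma via_trans2:
  assumes "via B a c" "B \<subseteq> M" "E \<subseteq> M" "a \<in> M" "c \<in> M" "\<And>b. b \<in> B \<Longrightarrow> via E a b"
  shows "via E a c"
  using via_trans1[of B c a E] assms by (simp add: via_sym)

lemma via_image:
  assumes "f \<in> Iso" "E \<subseteq> M" "a \<in> M" "c \<in> M"
  shows "via (f ` E) (f a) (f c) \<longleftrightarrow> via E a c"
  using assms by (force simp: via_def subset_iff)

lemma via_image_iv:
  assumes "f \<in> Iso" "E \<subseteq> M" "a \<in> M" "c \<in> M"
  shows "via (f ` E) (f a) c \<longleftrightarrow> via E a (iv f c)"
  using via_image[of f E a "iv f c"] assms by simp

text \<open>An independent pair is as far apart as its distances to \<open>E\<close> permit. Used in
  both directions, this gives stationarity: the distance of two independent points is determined by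
  their distances to \<open>E\<close>.\<close>

lemma via_le:
  assumes "via E a c" "a' \<in> M" "c' \<in> M" "E \<subseteq> M"
    and "\<And>e. e \<in> E \<Longrightarrow> d a' e = d a e" "\<And>e. e \<in> E \<Longrightarrow> d e c' = d e c"
  shows "d a' c' \<le> d a c"
proof -
  obtain e where "e \<in> E" "d a e + d e c \<le> d a c" using assms(1) by (auto simp: via_def)
  then show ?thesis using triangle[of a' e c'] assms by fastforce
qed

section \<open>Unbounded isometries and free realisations of types\<close>

definition jointly_unbounded :: "('a \<Rightarrow> 'a) set \<Rightarrow> bool"
  where "jointly_unbounded \<Phi> \<longleftrightarrow> (\<forall>N. \<exists>u\<in>M. \<forall>f\<in>\<Phi>. N \<le> d u (f u))"

text \<open>
  The type of \<open>x\<close> over \<open>X\<close> extends freely to the function \<open>p\<close>. One picks \<open>u\<close> with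
  \<open>d u z = p z + c\<close> on the relevant points and with large displacement, and then \<open>a\<close> between
  \<open>u\<close> and all these points, but free from \<open>f u\<close>; as \<open>f a\<close> is within \<open>c\<close> of \<open>f u\<close>, it is
  as far from \<open>a\<close> as possible.
\<close>

lemma free_point:
  assumes \<Phi>: "finite \<Phi>" "\<Phi> \<subseteq> Iso" "jointly_unbounded \<Phi>"
    and X: "finite X" "X \<noteq> {}" "X \<subseteq> M" and W: "finite W" "W \<subseteq> M" and x: "x \<in> M"
  obtains a where "a \<in> M" "\<And>e. e \<in> X \<Longrightarrow> d a e = d x e"
    "\<And>w. w \<in> W \<Longrightarrow> via X a w" "\<And>f. f \<in> \<Phi> \<Longrightarrow> via X a (f a)"
proof -
  \<comment> \<open>\<open>p\<close> is the largest admissible extension of the distances from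
    \<open>x\<close> to \<open>X\<close>: the length of a shortest path through
    \<open>X\<close>.\<close>
  define p where "p z = Min ((\<lambda>e. d x e + d e z) ` X)" for z
  have p_att: "\<exists>e\<in>X. p z = d x e + d e z" for z
    using Min_in[of "(\<lambda>e. d x e + d e z) ` X"] X unfolding p_def by blast
  have p_le: "p z \<le> d x e + d e z" if "e \<in> X" for z e
    unfolding p_def by (rule Min_le) (use that X in auto)
  have XM: "e \<in> M" if "e \<in> X" for e using X that by auto
  have p_ge: "d x z \<le> p z" if "z \<in> M" for z
    using p_att[of z] triangle[OF x _ that] XM by force
  have p_nn: "0 \<le> p z" if "z \<in> M" for z
    using p_ge[OF that] nonneg[of x z] by linarith
  have p_X: "p e = d x e" if "e \<in> X" for e
    using p_le[OF that, of e] p_ge[of e] XM[OF that] by simp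
  have p_lip: "p z \<le> p y + d z y" if "z \<in> M" "y \<in> M" for z y
  proof -
    obtain e where e: "e \<in> X" "p y = d x e + d e y" using p_att by blast
    then show ?thesis
      using p_le[OF e(1), of z] triangle[OF XM[OF e(1)] that(2,1)] commute[of z y] by simp
  qed
  have p_tri: "d z y \<le> p z + p y" if "z \<in> M" "y \<in> M" for z y
    using triangle[of z x y] p_ge[OF that(1)] p_ge[OF that(2)] that x commute[of z x] by simp
  \<comment> \<open>The preimages of \<open>X\<close> are included because \<open>d (f a) e\<close>
    is read off as \<open>d a (iv f e)\<close>.\<close>
  define Z where "Z = X \<union> W \<union> (\<Union>f\<in>\<Phi>. iv f ` X)"
  have Z: "finite Z" "Z \<subseteq> M" "X \<subseteq> Z" "W \<subseteq> Z" "Z \<noteq> {}"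
    using \<Phi> X W XM by (auto simp: Z_def)
  have ZM: "z \<in> M" if "z \<in> Z" for z using Z that by auto
  obtain z0 where z0: "z0 \<in> X" using X by blast
  then have z0': "z0 \<in> Z" "z0 \<in> M" using Z by auto
  define D where "D = Max ((\<lambda>z. p z + d z z0) ` Z)"
  have D: "p z + d z z0 \<le> D" if "z \<in> Z" for z
    unfolding D_def by (rule Max_ge) (use that Z in auto)
  \<comment> \<open>The point \<open>u\<close> chosen later lies within \<open>r \<le> D\<close> of
    \<open>v\<close>, so a displacement of \<open>4 * D\<close> at \<open>v\<close> leaves at least
    \<open>2 * D\<close> at \<open>u\<close>. This exceeds or equals \<open>p (f u) - c\<close>, as
    needed to place \<open>a\<close>.\<close>
  obtain v where v: "v \<in> M" "\<And>f. f \<in> \<Phi> \<Longrightarrow> 4 * D \<le> d v (f v)"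
    using \<Phi>(3) unfolding jointly_unbounded_def by blast
  define c where "c = d v z0"
  \<comment> \<open>The least distance from \<open>v\<close> that the triangle inequality allows for
    a point at distance \<open>p z + c\<close> from every \<open>z\<close> in \<open>Z\<close>.
    Taking \<open>c\<close> to be \<open>d v z0\<close> keeps it below \<open>D\<close>.\<close>
  define r where "r = Max ((\<lambda>z. \<bar>p z + c - d v z\<bar>) ` Z)"
  have r_ge: "\<bar>p z + c - d v z\<bar> \<le> r" if "z \<in> Z" for z
    unfolding r_def by (rule Max_ge) (use that Z in auto)
  obtain z1 where z1: "z1 \<in> Z" "r = \<bar>p z1 + c - d v z1\<bar>"
    using Max_in[of "(\<lambda>z. \<bar>p z + c - d v z\<bar>) ` Z"] Z unfolding r_def by blast
  have c0: "0 \<le> c" by (simp add: c_def)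
  have r0: "0 \<le> r" using z1 by simp
  have rD: "r \<le> D"
  proof -
    have "d v z0 \<le> d v z1 + d z1 z0" "d v z1 \<le> d v z0 + d z0 z1"
      using triangle v(1) ZM[OF z1(1)] z0'(2) by blast+
    then show ?thesis using D[OF z1(1)] z1(2) p_nn[OF ZM[OF z1(1)]] commute[of z0 z1]
      by (simp add: c_def abs_if split: if_splits)
  qed
  have r_le: "r \<le> p z + c + d v z" if "z \<in> Z" for z
  proof -
    have "p z1 \<le> p z + d z1 z" "d z1 z \<le> d v z1 + d v z" "d v z1 \<le> d v z + d z z1"
      "d z1 z \<le> p z1 + p z" "d z z1 = d z1 z"
      using p_lip[of z1 z] p_tri[of z1 z] triangle[of v z z1] triangle''[of z1 v z]
        v(1) ZM[OF that] ZM[OF z1(1)] commute[of z z1] by auto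
    then show ?thesis using z1(2) c0 p_nn[OF ZM[OF that]] by (simp add: abs_if split: if_splits)
  qed
  obtain u where u: "u \<in> M"
    "\<And>z s. (z, s) \<in> insert (v, r) ((\<lambda>z. (z, p z + c)) ` Z) \<Longrightarrow> d u z = s"
  proof (rule katetov_realise[of "insert (v, r) ((\<lambda>z. (z, p z + c)) ` Z)"])
    have zv: "p z + c \<le> r + d z v" "p z + c \<le> r + d v z" "r \<le> p z + c + d z v"
      "d z v \<le> p z + c + r" "d v z \<le> r + (p z + c)" if "z \<in> Z" for z
      using r_ge[OF that] r_le[OF that] commute[of v z] by (simp_all add: abs_le_iff)
    have zz: "p z \<le> p y + d z y" "d z y \<le> 2 * c + (p z + p y)" if "z \<in> Z" "y \<in> Z" for z y
      using p_lip[of z y] p_tri[of z y] ZM that c0 by simp_all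
    fix x1 r1 y1 s1
    assume "(x1, r1) \<in> insert (v, r) ((\<lambda>z. (z, p z + c)) ` Z)"
      "(y1, s1) \<in> insert (v, r) ((\<lambda>z. (z, p z + c)) ` Z)"
    then have "r1 \<le> s1 + d x1 y1 \<and> d x1 y1 \<le> r1 + s1"
      using v r0
      by (elim insertE imageE; clarsimp simp: zv zz r_le)
    then show "r1 \<le> s1 + d x1 y1" "d x1 y1 \<le> r1 + s1" by auto
  qed (use Z v in auto)
  have uZ: "d u z = p z + c" if "z \<in> Z" for z using u(2) that by blast
  have uv: "d u v = r" using u(2) by blast
  have far: "p (f u) - c \<le> d u (f u)" and att: "p (f u) = d x e + d e (f u) \<Longrightarrow> e \<in> X \<Longrightarrow>
      d (f u) e = p (iv f e) + c" if f: "f \<in> \<Phi>" for f e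
  proof -
    have fI: "f \<in> Iso" using f \<Phi> by auto
    have ivZ: "iv f e \<in> Z" if "e \<in> X" for e using that f by (auto simp: Z_def)
    have fe: "d (f u) e = p (iv f e) + c" if "e \<in> X" for e
      using uZ[OF ivZ[OF that]] iso_dist_iv1[OF fI u(1)] XM[OF that] by simp
    then show "p (f u) = d x e + d e (f u) \<Longrightarrow> e \<in> X \<Longrightarrow> d (f u) e = p (iv f e) + c" .
    have "p (f u) \<le> d x z0 + d z0 (f u)" by (rule p_le[OF z0])
    also have "\<dots> = p z0 + p (iv f z0) + c" using fe[OF z0] p_X[OF z0] commute[of z0] by simp
    finally have 1: "p (f u) - c \<le> 2 * D"
      using D[OF ivZ[OF z0]] D[OF z0'(1)] nonneg[of "iv f z0" z0] nonneg[of z0 z0] by linarith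
    have "d v (f v) \<le> d v u + d u (f v)" "d u (f v) \<le> d u (f u) + d (f u) (f v)"
      by (rule triangle; use u v fI in simp)+
    then have "4 * D \<le> d u (f u) + 2 * r"
      using v(2)[OF f] uv fI u v commute[of v u] by simp
    then show "p (f u) - c \<le> d u (f u)" using 1 rD by linarith
  qed
  define Z' where "Z' = Z \<union> (\<lambda>f. f u) ` \<Phi>"
  have Z': "finite Z'" "Z' \<subseteq> M" using Z \<Phi> u by (auto simp: Z'_def)
  have uZ': "d u z \<le> p z + c \<and> p z \<le> c + d u z \<and> c \<le> p z + d u z" if "z \<in> Z'" for z
  proof -
    have zM: "z \<in> M" using that Z' by auto
    obtain e where e: "e \<in> X" "p z = d x e + d e z" using p_att by blast
    have eZ: "e \<in> Z" using e Z by auto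
    have "d u e \<le> d u z + d e z" "d u z \<le> d u e + d e z"
      using triangle'[of u z e] triangle[of u e z] u(1) zM XM[OF e(1)] by auto
    moreover have "p z \<le> c + d u z"
      using that far uZ c0 by (force simp: Z'_def)
    ultimately show ?thesis using e uZ[OF eZ] p_X[OF e(1)] nonneg[of x e] by linarith
  qed
  obtain a where a: "a \<in> M"
    "\<And>z s. (z, s) \<in> insert (u, c) ((\<lambda>z. (z, p z)) ` Z') \<Longrightarrow> d a z = s"
  proof (rule katetov_realise[of "insert (u, c) ((\<lambda>z. (z, p z)) ` Z')"])
    have zu: "p z \<le> c + d z u" "p z \<le> c + d u z" "c \<le> p z + d z u"  "c \<le> p z + d u z"
      "d z u \<le> p z + c" "d u z \<le> c + p z" if "z \<in> Z'" for z
      using uZ'[OF that] commute[of u z] by simp_all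
    have zz: "p z \<le> p y + d z y" "d z y \<le> p z + p y" if "z \<in> Z'" "y \<in> Z'" for z y
      using p_lip[of z y] p_tri[of z y] Z' that by auto
    fix x1 r1 y1 s1
    assume "(x1, r1) \<in> insert (u, c) ((\<lambda>z. (z, p z)) ` Z')"
      "(y1, s1) \<in> insert (u, c) ((\<lambda>z. (z, p z)) ` Z')"
    then have "r1 \<le> s1 + d x1 y1 \<and> d x1 y1 \<le> r1 + s1"
      using u(1) c0 by (elim insertE imageE; clarsimp simp: zu zz)
    then show "r1 \<le> s1 + d x1 y1" "d x1 y1 \<le> r1 + s1" by auto
  qed (use Z' u in auto)
  have aZ: "d a z = p z" if "z \<in> Z'" for z using a(2) that by blast
  have au: "d a u = c" using a(2) by blast
  have aX: "d a e = d x e" if "e \<in> X" for e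
    using aZ[of e] that Z p_X by (auto simp: Z'_def)
  show thesis
  proof (rule that[OF a(1) aX])
    fix w assume "w \<in> W"
    then have "d a w = p w" using aZ Z by (auto simp: Z'_def)
    then show "via X a w" using p_att[of w] aX by (auto simp: via_def)
  next
    fix f assume f: "f \<in> \<Phi>"
    then have fI: "f \<in> Iso" using \<Phi> by auto
    \<comment> \<open>From \<open>d a (f u) = p (f u)\<close> and \<open>d (f a) (f u) = c\<close>
      follows \<open>p (f u) - c \<le> d a (f a)\<close>. For the point \<open>e\<close> at which
      \<open>p (f u)\<close> is attained, the left side equals
      \<open>d a e + d e (f a)\<close>.\<close>
    obtain e where e: "e \<in> X" "p (f u) = d x e + d e (f u)" using p_att by blast
    have eM: "e \<in> M" using XM e by blast
    have "iv f e \<in> Z" using e f by (auto simp: Z_def)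
    then have "d a (iv f e) = p (iv f e)" using aZ by (auto simp: Z'_def)
    then have fae: "d (f a) e = p (iv f e)" using iso_dist_iv1[OF fI a(1) eM] by simp
    have "p (f u) = d a (f u)" using aZ f by (simp add: Z'_def)
    also have "\<dots> \<le> d a (f a) + d (f a) (f u)" by (rule triangle) (use a u fI in auto)
    finally have "p (f u) \<le> d a (f a) + c" using fI a u au by simp
    then show "via X a (f a)"
      using att[OF f e(2) e(1)] fae e aX[OF e(1)] commute[of e]
      by (auto simp: via_def intro!: bexI[of _ e])
  qed
qed

definition unbounded :: "('a \<Rightarrow> 'a) \<Rightarrow> bool"
  where "unbounded f \<longleftrightarrow> f \<in> Iso \<and> jointly_unbounded {f}"

lemma unbounded_iso [simp]: "unbounded f \<Longrightarrow> f \<in> Iso"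
  by (simp add: unbounded_def)

lemma unboundedD: "unbounded f \<Longrightarrow> \<exists>u\<in>M. N \<le> d u (f u)"
  by (simp add: unbounded_def jointly_unbounded_def)

lemma unbounded_iv:
  assumes "unbounded f" shows "unbounded (iv f)"
  unfolding unbounded_def jointly_unbounded_def
proof (intro conjI allI)
  fix N
  obtain u where u: "u \<in> M" "N \<le> d u (f u)" using unboundedD[OF assms] by blast
  have f: "f \<in> Iso" using assms by simp
  show "\<exists>u\<in>M. \<forall>f\<in>{iv f}. N \<le> d u (f u)"
    using u f commute[of u "f u"] by (intro bexI[of _ "f u"]) auto
qed (use assms in simp)

lemma jointly_unbounded_empty [simp]: "jointly_unbounded {}"
  using M_nonempty by (auto simp: jointly_unbounded_def)

text \<open>Around a point \<open>v\<close> that \<open>g\<close> moves by at least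
  \<open>3 * N\<close>, choose \<open>a\<close> at distance \<open>N\<close> from \<open>v\<close>
  and free from \<open>f a\<close> over \<open>v\<close>. Then \<open>f\<close> moves
  \<open>a\<close> by at least \<open>N\<close>, and \<open>g\<close> still moves it by at least
  \<open>3 * N - 2 * N\<close>.\<close>

lemma jointly_unbounded_pair:
  assumes f: "unbounded f" and g: "unbounded g"
  shows "jointly_unbounded {f, g}"
  unfolding jointly_unbounded_def
proof
  fix N0 :: real
  define N where "N = max N0 0"
  obtain v where v: "v \<in> M" "3 * N \<le> d v (g v)" using unboundedD[OF g] by blast
  obtain x where x: "x \<in> M" "d x v = N"
    using katetov_realise[of "{(v, N)}"] v by (auto simp: N_def)
  obtain a where a: "a \<in> M" "d a v = d x v" "via {v} a (f a)"
    by (rule free_point[of "{f}" "{v}" "{}" x]) (use f v x in \<open>auto simp: unbounded_def\<close>)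
  have "N \<le> d a v + d v (f a)" using a(2) x by simp
  also have "\<dots> \<le> d a (f a)" using a(3) by (simp add: via_def)
  finally have "N \<le> d a (f a)" .
  moreover have "d v (g v) \<le> d v a + d a (g v)" "d a (g v) \<le> d a (g a) + d (g a) (g v)"
    by (rule triangle; use a v g in simp)+
  then have "N \<le> d a (g a)" using v g a x commute[of v a] by simp
  ultimately show "\<exists>u\<in>M. \<forall>h\<in>{f, g}. N0 \<le> d u (h u)"
    using a(1) by (intro bexI[of _ a]) (auto simp: N_def)
qed

section \<open>Moving finite sets into free position\<close>

definition fixes_on :: "'a set \<Rightarrow> ('a \<Rightarrow> 'a) \<Rightarrow> bool"
  where "fixes_on E k \<longleftrightarrow> k \<in> Iso \<and> (\<forall>e\<in>E. k e = e)"

lemma fixes_onD: "fixes_on E k \<Longrightarrow> k \<in> Iso" "fixes_on E k \<Longrightarrow> e \<in> E \<Longrightarrow> k e = e"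
  by (auto simp: fixes_on_def)

lemma fixes_on_iv: "fixes_on E k \<Longrightarrow> E \<subseteq> M \<Longrightarrow> fixes_on E (iv k)"
  unfolding fixes_on_def using iv_app1[of k] by (metis iso_iv subsetD)

lemma fixes_on_mono: "fixes_on E k \<Longrightarrow> F \<subseteq> E \<Longrightarrow> fixes_on F k"
  by (auto simp: fixes_on_def)

lemma fixes_on_image: "fixes_on E k \<Longrightarrow> k ` E = E"
  by (force simp: fixes_on_def)

text \<open>Points are moved one at a time. Each new point is made free over \<open>E\<close>
  together with the points already placed, and transitivity of independence then reduces the base to
  \<open>E\<close>. The condition \<open>FE\<close> starts this reduction, since it covers the
  images of \<open>E\<close> itself.\<close>

lemma free_set_aux:
  assumes \<Phi>: "finite \<Phi>" "\<Phi> \<subseteq> Iso" "jointly_unbounded \<Phi>"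
    and E: "finite E" "E \<noteq> {}" "E \<subseteq> M" and W: "finite W" "W \<subseteq> M"
    and FE: "\<And>f. f \<in> \<Phi> \<Longrightarrow> f ` E \<subseteq> W" and F: "finite F" "F \<subseteq> M"
  shows "\<exists>k. fixes_on E k \<and> (\<forall>x\<in>F. \<forall>w\<in>W. via E (k x) w) \<and>
    (\<forall>x\<in>F. \<forall>y\<in>F. \<forall>f\<in>\<Phi>. via E (k x) (f (k y)))"
  using F
proof (induction F)
  case empty
  have "fixes_on E idm" using E by (auto simp: fixes_on_def)
  then show ?case by auto
next
  case (insert v F)
  then obtain k where k: "fixes_on E k" "\<forall>x\<in>F. \<forall>w\<in>W. via E (k x) w"
    "\<forall>x\<in>F. \<forall>y\<in>F. \<forall>f\<in>\<Phi>. via E (k x) (f (k y))" by auto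
  have kI [simp]: "k \<in> Iso" using k fixes_onD by blast
  have vM: "v \<in> M" "F \<subseteq> M" using insert.prems by auto
  define X where "X = E \<union> k ` F"
  have X: "finite X" "X \<noteq> {}" "X \<subseteq> M" using E insert.hyps vM by (auto simp: X_def)
  \<comment> \<open>Images of \<open>X\<close> control pairs with the new point in the first place;
    preimages control pairs where the new point is the one moved by \<open>f\<close>.\<close>
  define W' where "W' = W \<union> (\<Union>f\<in>\<Phi>. f ` X \<union> iv f ` X)"
  have fI: "f \<in> Iso" if "f \<in> \<Phi>" for f using \<Phi> that by auto
  have W': "finite W'" "W' \<subseteq> M" using W X \<Phi>(1) fI by (auto simp: W'_def)
  obtain a where a: "a \<in> M" "\<And>e. e \<in> X \<Longrightarrow> d a e = d (k v) e"
    "\<And>w. w \<in> W' \<Longrightarrow> via X a w" "\<And>f. f \<in> \<Phi> \<Longrightarrow> via X a (f a)"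
    using free_point[OF \<Phi> X W', of "k v"] vM by auto
  obtain m where m: "m \<in> Iso" "\<And>x x'. (x, x') \<in> insert (k v, a) (Id_on X) \<Longrightarrow> m x = x'"
  proof (rule homogeneous_rel[of "insert (k v, a) (Id_on X)"])
    show "insert (k v, a) (Id_on X) \<subseteq> M \<times> M" using X a vM by auto
    fix x x' y y' assume "(x, x') \<in> insert (k v, a) (Id_on X)" "(y, y') \<in> insert (k v, a) (Id_on X)"
    then show "d x' y' = d x y"
      using a(1,2) vM commute by (auto simp: Id_on_iff) metis
  qed (use X in \<open>auto simp: Id_on_def\<close>)
  have mX: "m e = e" if "e \<in> X" for e using m(2) that by auto
  have mv: "m (k v) = a" using m(2) by blast
  define k' where "k' = m \<star> k"
  have k'F: "k' x = k x" if "x \<in> F" for x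
    using that vM m mX by (auto simp: k'_def X_def)
  have k'v: "k' v = a" using vM m mv by (simp add: k'_def)
  have XM: "x \<in> X \<Longrightarrow> x \<in> M" for x using X by auto
  have WM: "w \<in> W \<Longrightarrow> w \<in> M" for w using W by auto
  have X_via_fX: "via E b (f y)" if "b \<in> X" "y \<in> X" "f \<in> \<Phi>" for b y f
    using that k(2,3) FE[OF that(3)] E via_in1[of b E] by (auto simp: X_def)
  have av: "via E a (f y)" if "y \<in> X" "f \<in> \<Phi>" for y f
  proof (rule via_trans1[of X])
    show "via X a (f y)" using a(3) that by (auto simp: W'_def)
  qed (use X E a XM that fI X_via_fX in auto)
  have vX: "via E y (f a)" if y: "y \<in> X" and f: "f \<in> \<Phi>" for y f
  \<comment> \<open>Freeness of \<open>a\<close> from \<open>iv f y\<close> over \<open>X\<close> is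
    pushed forward by \<open>f\<close>, giving freeness of \<open>f a\<close> from \<open>y\<close>
    over the image of \<open>X\<close>.\<close>
  proof (rule via_trans2[of "f ` X"])
    have "via X a (iv f y)" using a(3) that by (auto simp: W'_def)
    then show "via (f ` X) y (f a)"
      using via_image_iv[of f X a y] fI[OF f] X a XM[OF y] by (simp add: via_sym)
  qed (use X E a XM that fI X_via_fX in auto)
  have aa: "via E a (f a)" if f: "f \<in> \<Phi>" for f
    by (rule via_trans1[OF a(4)[OF f]]) (use X E a fI f vX in auto)
  have aW: "via E a w" if w: "w \<in> W" for w
  proof (rule via_trans1[of X])
    show "via X a w" using a(3) w by (auto simp: W'_def)
  qed (use X E a WM w k(2) via_in1 in \<open>auto simp: X_def\<close>)
  have kFX: "x \<in> F \<Longrightarrow> k x \<in> X" for x by (simp add: X_def)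
  have "fixes_on E k'"
    using E k(1) m mX by (auto simp: fixes_on_def k'_def X_def subset_iff)
  moreover have "\<forall>x\<in>insert v F. \<forall>w\<in>W. via E (k' x) w"
    using aW k(2) by (auto simp: k'v k'F)
  moreover have "\<forall>x\<in>insert v F. \<forall>y\<in>insert v F. \<forall>f\<in>\<Phi>. via E (k' x) (f (k' y))"
    using aa av vX k(3) kFX by (auto simp: k'v k'F)
  ultimately show ?case by blast
qed

text \<open>Adding the images of \<open>E\<close> to \<open>W\<close> meets the condition
  \<open>FE\<close> of \<open>free_set_aux\<close>.\<close>

lemma free_set:
  assumes \<Phi>: "finite \<Phi>" "\<Phi> \<subseteq> Iso" "jointly_unbounded \<Phi>"
    and E: "finite E" "E \<noteq> {}" "E \<subseteq> M" and W: "finite W" "W \<subseteq> M"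
    and F: "finite F" "F \<subseteq> M"
  obtains k where "fixes_on E k" "\<And>x w. x \<in> F \<Longrightarrow> w \<in> W \<Longrightarrow> via E (k x) w"
    "\<And>x y f. x \<in> F \<Longrightarrow> y \<in> F \<Longrightarrow> f \<in> \<Phi> \<Longrightarrow> via E (k x) (f (k y))"
proof -
  have *: "finite (W \<union> (\<Union>f\<in>\<Phi>. f ` E))" "W \<union> (\<Union>f\<in>\<Phi>. f ` E) \<subseteq> M"
    using W \<Phi>(1) E(1) subsetD[OF \<Phi>(2)] subsetD[OF E(3)] by auto
  have "f ` E \<subseteq> W \<union> (\<Union>f\<in>\<Phi>. f ` E)" if "f \<in> \<Phi>" for f using that by auto
  from free_set_aux[OF \<Phi> E * this F] obtain k where "fixes_on E k"
    "\<forall>x\<in>F. \<forall>w\<in>W \<union> (\<Union>f\<in>\<Phi>. f ` E). via E (k x) w"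
    "\<forall>x\<in>F. \<forall>y\<in>F. \<forall>f\<in>\<Phi>. via E (k x) (f (k y))"
    by auto
  then show thesis by (intro that[of k]) auto
qed

text \<open>Some \<open>s\<close> fixing \<open>X\<close> moves \<open>A\<close> to a copy that is
  free from its own image under \<open>g\<close>. By stationarity this copy and its image have the
  same distances, among themselves and to \<open>X\<close> and its image, as \<open>A\<close> and
  its target under \<open>\<theta>\<close>. Homogeneity then supplies the conjugator.\<close>

lemma conjugate_realises:
  assumes g: "unbounded g" and X: "finite X" "X \<noteq> {}" "X \<subseteq> M"
    and \<theta>: "\<theta> \<in> Iso" "\<And>x. x \<in> X \<Longrightarrow> \<theta> x = g x"
    and A: "finite A" "A \<subseteq> M"
    and AY: "\<And>a x. a \<in> A \<Longrightarrow> x \<in> X \<Longrightarrow> via X a (g x)"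
    and TX: "\<And>a x. a \<in> A \<Longrightarrow> x \<in> X \<union> A \<Longrightarrow> via (g ` X) (\<theta> a) x"
  obtains k where "fixes_on (X \<union> g ` X) k" "\<And>a. a \<in> A \<Longrightarrow> k (g (iv k a)) = \<theta> a"
proof -
  have gI [simp]: "g \<in> Iso" using g by simp
  define W where "W = g ` X \<union> iv g ` X"
  have W: "finite W" "W \<subseteq> M" using X by (auto simp: W_def)
  obtain s where s: "fixes_on X s" "\<And>x w. x \<in> A \<Longrightarrow> w \<in> W \<Longrightarrow> via X (s x) w"
    "\<And>x y. x \<in> A \<Longrightarrow> y \<in> A \<Longrightarrow> via X (s x) (g (s y))"
    by (rule free_set[of "{g}" X W A]) (use g X W A in \<open>auto simp: unbounded_def\<close>)
  have sI [simp]: "s \<in> Iso" using s fixes_onD by blast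
  have XM [simp]: "x \<in> X \<Longrightarrow> x \<in> M" and AM [simp]: "x \<in> A \<Longrightarrow> x \<in> M" for x using X A by auto
  have \<theta>I [simp]: "\<theta> \<in> Iso" by fact
  have sX: "d (s a) x = d a x" if "a \<in> A" "x \<in> X" for a x
    using iso_dist[OF sI, of a x] fixes_onD(2)[OF s(1)] that by simp
  have g\<theta>: "d (g (s a)) (g x) = d (\<theta> a) (g x)" if "a \<in> A" "x \<in> X" for a x
    using iso_dist[OF \<theta>(1), of a x] \<theta>(2) sX that by simp
  \<comment> \<open>Both pairs are independent over \<open>X\<close> with equal distances to
    \<open>X\<close>, so \<open>via_le\<close> applies in both directions. The same scheme gives
    \<open>e2\<close> and \<open>e3\<close>, with the base changed where necessary.\<close>
  have e1: "d (s a) (g x) = d a (g x)" if a: "a \<in> A" and x: "x \<in> X" for a x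
  proof (rule antisym)
    show "d (s a) (g x) \<le> d a (g x)"
      by (rule via_le[OF AY[OF a x]]) (use a x X sX in auto)
    show "d a (g x) \<le> d (s a) (g x)"
      by (rule via_le[OF s(2)[OF a]]) (use a x X sX in \<open>auto simp: W_def\<close>)
  qed
  have gXM: "g ` X \<subseteq> M" using X by auto
  have e2: "d (g (s a)) x = d (\<theta> a) x" if a: "a \<in> A" and x: "x \<in> X" for a x
  proof (rule antisym)
    have "via X (s a) (iv g x)" using s(2)[OF a] x by (auto simp: W_def)
    then have "via (g ` X) (g (s a)) x" using via_image_iv[of g X "s a" x] a x X by simp
    then show "d (\<theta> a) x \<le> d (g (s a)) x"
      by (rule via_le) (use a x gXM g\<theta> in auto)
    show "d (g (s a)) x \<le> d (\<theta> a) x"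
      by (rule via_le[OF TX[OF a]]) (use a x gXM g\<theta> in auto)
  qed
  have e3: "d (s a) (g (s b)) = d a (\<theta> b)" if a: "a \<in> A" and b: "b \<in> A" for a b
  proof (rule antisym)
    have "d (g (s b)) (s a) \<le> d (\<theta> b) a"
      by (rule via_le[OF TX[OF b]]) (use a b gXM g\<theta> e1 commute[of _ a] commute[of _ "s a"] in auto)
    then show "d (s a) (g (s b)) \<le> d a (\<theta> b)" by (simp add: commute)
    show "d a (\<theta> b) \<le> d (s a) (g (s b))"
      by (rule via_le[OF s(3)[OF a b]]) (use a b X sX e2 commute[of _ "\<theta> b"] commute[of _ "g (s b)"] in auto)
  qed
  \<comment> \<open>The identity on \<open>X\<close> and its image, together with the two
    correspondences of the copies. The extension \<open>m\<close> leads from the prescribed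
    configuration to the actual one, so the conjugator is \<open>iv m\<close>.\<close>
  define R where "R = (\<lambda>x. (x, x)) ` X \<union> (\<lambda>x. (g x, g x)) ` X \<union> (\<lambda>a. (a, s a)) ` A \<union> (\<lambda>a. (\<theta> a, g (s a))) ` A"
  obtain m where m: "m \<in> Iso" "\<And>x x'. (x, x') \<in> R \<Longrightarrow> m x = x'"
  proof (rule homogeneous_rel[of R])
    show "finite R" using X A by (auto simp: R_def)
    show "R \<subseteq> M \<times> M" using X A by (auto simp: R_def)
    have sX': "d x (s a) = d x a" "d (g x) (s a) = d (g x) a" "d x (g (s a)) = d x (\<theta> a)"
        "d (g x) (g (s a)) = d (g x) (\<theta> a)" if "a \<in> A" "x \<in> X" for a x
      using sX[OF that] e1[OF that] e2[OF that] g\<theta>[OF that]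
        commute[of x] commute[of "g x"] by simp_all
    have e3': "d (g (s b)) (s a) = d (\<theta> b) a" if "a \<in> A" "b \<in> A" for a b
      using e3[OF that] commute[of "g (s b)"] commute[of "\<theta> b"] by simp
    have e4: "d (g (s a)) (g (s b)) = d (\<theta> a) (\<theta> b)" "d (s a) (s b) = d a b"
      if "a \<in> A" "b \<in> A" for a b
      using that by simp_all
    fix x x' y y' assume "(x, x') \<in> R" "(y, y') \<in> R"
    then show "d x' y' = d x y"
      unfolding R_def Un_iff image_iff prod.inject
      by (elim disjE bexE conjE; simp only:)
         (rule refl | (rule sX e1 e2 g\<theta> sX' e3 e3' e4; assumption))+
  qed blast
  have mf: "fixes_on (X \<union> g ` X) m" using m by (auto simp: fixes_on_def R_def)
  have ma: "m a = s a" "m (\<theta> a) = g (s a)" if "a \<in> A" for a using m(2) that by (auto simp: R_def)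
  have "iv m (g (iv (iv m) a)) = \<theta> a" if "a \<in> A" for a
    using ma[OF that] iv_app1[OF m(1), of "\<theta> a"] that m(1) by simp
  moreover have "fixes_on (X \<union> g ` X) (iv m)" using mf X gXM by (intro fixes_on_iv) auto
  ultimately show thesis using that by blast
qed

subsection \<open>Chains of conjugates\<close>

abbreviation cj where "cj k g \<equiv> k \<star> g \<star> iv k"

lemma cj_mul: "s \<in> Iso \<Longrightarrow> k \<in> Iso \<Longrightarrow> g \<in> Iso \<Longrightarrow> cj (s \<star> k) g = cj s (cj k g)"
  by (simp add: isom.inv_mult_group isom.m_assoc)

lemma iv_cj: "s \<in> Iso \<Longrightarrow> g \<in> Iso \<Longrightarrow> iv (cj s g) = cj s (iv g)"
  by (simp add: isom.inv_mult_group isom.m_assoc)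

lemma unbounded_cj:
  assumes g: "unbounded g" and k: "k \<in> Iso"
  shows "unbounded (cj k g)"
  unfolding unbounded_def jointly_unbounded_def
proof (intro conjI allI)
  have gI: "g \<in> Iso" using g by simp
  then show "cj k g \<in> Iso" using k by simp
  fix N
  obtain u where u: "u \<in> M" "N \<le> d u (g u)" using unboundedD[OF g] by blast
  then show "\<exists>u\<in>M. \<forall>f\<in>{cj k g}. N \<le> d u (f u)"
    using k gI by (intro bexI[of _ "k u"]) auto
qed

lemma iv_mul_fix:
  "fixes_on E s \<Longrightarrow> k \<in> Iso \<Longrightarrow> x \<in> E \<Longrightarrow> x \<in> M \<Longrightarrow> iv (s \<star> k) x = iv k x"
  using fixes_onD[of E s] iv_app1[of s x] by (simp add: isom.inv_mult_group)

lemma fixes_on_iv_app: "fixes_on E s \<Longrightarrow> x \<in> E \<Longrightarrow> x \<in> M \<Longrightarrow> iv s x = x"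
  using fixes_onD[of E s] iv_app1[of s x] by simp

text \<open>The factor of \<open>k 0\<close> acts first. The partial products give the positions of
  a point along the chain, on which the conjugators are frozen below.\<close>

primrec chain :: "('a \<Rightarrow> 'a) \<Rightarrow> (nat \<Rightarrow> 'a \<Rightarrow> 'a) \<Rightarrow> nat \<Rightarrow> 'a \<Rightarrow> 'a" where
  "chain g k 0 = idm"
| "chain g k (Suc i) = cj (k i) g \<star> chain g k i"

lemma chain_iso [simp]: "g \<in> Iso \<Longrightarrow> (\<And>i. k i \<in> Iso) \<Longrightarrow> chain g k i \<in> Iso"
  by (induction i) auto

text \<open>
  Only the inverses of the conjugators are frozen, and only on the points that the chain
  starting in \<open>X\<close> passes; this already determines the chain on \<open>X\<close>.
\<close>

definition agree :: "('a \<Rightarrow> 'a) \<Rightarrow> (nat \<Rightarrow> 'a \<Rightarrow> 'a) \<Rightarrow> 'a set \<Rightarrow> (nat \<Rightarrow> 'a \<Rightarrow> 'a) \<Rightarrow> bool"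
  where "agree g k X k' \<longleftrightarrow>
    (\<forall>i<4. \<forall>x\<in>X. \<forall>y\<in>{chain g k i x, chain g k (Suc i) x}. iv (k' i) y = iv (k i) y)"

text \<open>If \<open>p\<close> and \<open>y\<close> are consecutive positions, then
  \<open>iv (k i) y = g (iv (k i) p)\<close>. Both inverse values are frozen, so the conjugate by
  \<open>k' i\<close> also sends \<open>p\<close> to \<open>y\<close>.\<close>

lemma agree_chain:
  assumes "g \<in> Iso" "\<And>i. k i \<in> Iso" "\<And>i. k' i \<in> Iso" "agree g k X k'" "x \<in> X" "X \<subseteq> M" "i \<le> 4"
  shows "chain g k' i x = chain g k i x"
  using assms(7)
proof (induction i)
  case 0
  show ?case by simp
next
  case (Suc i)
  have xM: "x \<in> M" using assms by auto
  have ag: "iv (k' i) (chain g k i x) = iv (k i) (chain g k i x)"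
    "iv (k' i) (chain g k (Suc i) x) = iv (k i) (chain g k (Suc i) x)"
    using assms Suc by (auto simp: agree_def)
  define y where "y = chain g k (Suc i) x"
  have yM: "y \<in> M" unfolding y_def using assms xM by (meson chain_iso iso_in)
  have "iv (k i) y = g (iv (k i) (chain g k i x))"
    using assms(1,2) xM by (simp add: y_def)
  then have "k' i (g (iv (k' i) (chain g k i x))) = k' i (iv (k' i) y)"
    using ag by (simp add: y_def)
  then have "k' i (g (iv (k' i) (chain g k i x))) = y" using assms(3) yM by simp
  then show ?case using Suc assms(1,2,3) xM by (simp add: y_def)
qed

lemma agree_trans:
  assumes "g \<in> Iso" "\<And>i. k i \<in> Iso" "\<And>i. k' i \<in> Iso" "agree g k X k'" "agree g k' X' k''"
    "X \<subseteq> X'" "X \<subseteq> M"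
  shows "agree g k X k''"
proof -
  have "iv (k'' i) y = iv (k i) y"
    if i: "i < 4" and x: "x \<in> X" and y: "y \<in> {chain g k i x, chain g k (Suc i) x}" for i x y
  proof -
    have "chain g k' i x = chain g k i x" "chain g k' (Suc i) x = chain g k (Suc i) x"
      using i x by (intro agree_chain[OF assms(1-4)] assms; simp)+
    then have "y \<in> {chain g k' i x, chain g k' (Suc i) x}" using y by (simp only:)
    then have "iv (k'' i) y = iv (k' i) y"
      using assms(5) i subsetD[OF assms(6) x] unfolding agree_def by blast
    moreover have "iv (k' i) y = iv (k i) y" using assms(4) i x y unfolding agree_def by blast
    ultimately show ?thesis by simp
  qed
  then show ?thesis by (auto simp: agree_def)
qed

text \<open>A form of local openness of the product map: every isometry that extends the chain on
  \<open>X\<close> is approximated, exactly on finite sets, by chains with the same frozen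
  data.\<close>

definition flexible :: "('a \<Rightarrow> 'a) \<Rightarrow> (nat \<Rightarrow> 'a \<Rightarrow> 'a) \<Rightarrow> 'a set \<Rightarrow> bool"
  where "flexible g k X \<longleftrightarrow>
    (\<forall>\<psi>\<in>Iso. (\<forall>x\<in>X. \<psi> x = chain g k 4 x) \<longrightarrow>
      (\<forall>A. finite A \<longrightarrow> A \<subseteq> M \<longrightarrow>
        (\<exists>k'. (\<forall>i. k' i \<in> Iso) \<and> agree g k X k' \<and> (\<forall>x\<in>A. chain g k' 4 x = \<psi> x))))"

text \<open>Some \<open>k\<close> makes \<open>A\<close> free from the preimage of \<open>Y\<close>.
  After applying \<open>f\<close>, the hypothesis \<open>H\<close> shrinks the base to the image of
  \<open>X\<close>, and conjugating back by \<open>iv k\<close> disturbs neither this base nor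
  \<open>Y\<close>.\<close>

lemma free_image:
  assumes f: "f \<in> Iso" and X: "finite X" "X \<noteq> {}" "X \<subseteq> M" and Y: "finite Y" "Y \<subseteq> M"
    and H: "\<And>a b. a \<in> f ` X \<union> Y \<Longrightarrow> b \<in> Y \<Longrightarrow> via (f ` X) (f a) b"
    and A: "finite A" "A \<subseteq> M"
  obtains s where "fixes_on (X \<union> f ` X \<union> Y) s"
    "\<And>a b. a \<in> A \<Longrightarrow> b \<in> Y \<Longrightarrow> via (f ` X) (cj s f a) b"
proof -
  define E where "E = X \<union> f ` X \<union> Y"
  have E: "finite E" "E \<noteq> {}" "E \<subseteq> M" and fX: "f ` X \<subseteq> M" using X Y f by (auto simp: E_def)
  obtain k where k: "fixes_on E k" "\<And>x w. x \<in> A \<Longrightarrow> w \<in> iv f ` Y \<Longrightarrow> via E (k x) w"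
    by (rule free_set[of "{}" E "iv f ` Y" A]) (use E Y A f in auto)
  have kI: "k \<in> Iso" using k fixes_onD by blast
  have s: "fixes_on E (iv k)" using fixes_on_iv k E by blast
  have "via (f ` X) (cj (iv k) f a) b" if a: "a \<in> A" and b: "b \<in> Y" for a b
  proof -
    have aM: "a \<in> M" and bM: "b \<in> M" using a b A Y by auto
    have "via E (k a) (iv f b)" using k(2) a b by blast
    then have "via (f ` E) (f (k a)) b"
      using via_image_iv[of f E "k a" b] f E kI aM bM by simp
    then have "via (f ` X) (f (k a)) b"
    proof (rule via_trans1)
      fix c assume "c \<in> f ` E"
      then consider x where "x \<in> X" "c = f x" | x where "x \<in> f ` X \<union> Y" "c = f x"
        by (auto simp: E_def)
      then show "via (f ` X) c b"
      proof cases
        case 1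
        then show ?thesis using via_in1[of c "f ` X" b] fX by auto
      qed (use H b in auto)
    qed (use E f fX kI aM bM in auto)
    then have "via (iv k ` f ` X) (iv k (f (k a))) (iv k b)"
      using via_image[of "iv k" "f ` X" "f (k a)" b] kI f fX aM bM by simp
    moreover have "iv k ` f ` X = f ` X"
      by (rule fixes_on_image[OF fixes_on_mono[OF s]]) (auto simp: E_def)
    moreover have "iv k b = b" using fixes_onD(2)[OF s] b by (simp add: E_def)
    moreover have "cj (iv k) f a = iv k (f (k a))" using kI f aM by simp
    ultimately show ?thesis by simp
  qed
  with s show thesis using that unfolding E_def by blast
qed

lemma less_4: "(\<forall>i<4. P i) \<longleftrightarrow> P 0 \<and> P (Suc 0) \<and> P (Suc (Suc 0)) \<and> P (Suc (Suc (Suc 0)))"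
  by (simp add: eval_nat_numeral All_less_Suc) blast

lemma chain_4:
  "chain g k 4 = cj (k 3) g \<star> (cj (k 2) g \<star> (cj (k 1) g \<star> (cj (k 0) g \<star> idm)))"
  by (simp add: eval_nat_numeral)

text \<open>
  The two ends of the chain only have to be independent from the middle: the images in the middle
  can then be chosen freely, and \<open>conjugate_realises\<close> reaches them from both sides.
\<close>

lemma flexibleI:
  assumes g: "unbounded g" and k: "\<And>i. k i \<in> Iso" and X: "finite X" "X \<noteq> {}" "X \<subseteq> M"
    and H1: "\<And>a b. a \<in> chain g k 1 ` X \<union> chain g k 2 ` X \<Longrightarrow> b \<in> chain g k 2 ` X \<Longrightarrow>
      via (chain g k 1 ` X) (cj (k 0) g a) b"
    and H4: "\<And>a b. a \<in> chain g k 3 ` X \<union> chain g k 2 ` X \<Longrightarrow> b \<in> chain g k 2 ` X \<Longrightarrow>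
      via (chain g k 3 ` X) (iv (cj (k 3) g) a) b"
  shows "flexible g k X"
  unfolding flexible_def
proof (intro ballI impI allI)
  fix \<psi> A
  assume \<psi>: "\<psi> \<in> Iso" "\<forall>x\<in>X. \<psi> x = chain g k 4 x" and A: "finite A" "A \<subseteq> M"
  have gI: "g \<in> Iso" using g by simp
  define g1 where "g1 = cj (k 0) g"
  define g2 where "g2 = cj (k 1) g"
  define g3 where "g3 = cj (k 2) g"
  define g4 where "g4 = cj (k 3) g"
  have gs [simp]: "g1 \<in> Iso" "g2 \<in> Iso" "g3 \<in> Iso" "g4 \<in> Iso"
    using gI k by (simp_all add: g1_def g2_def g3_def g4_def)
  have ub: "unbounded g2" "unbounded g3" using unbounded_cj[OF g] k by (simp_all add: g2_def g3_def)
  define X1 where "X1 = g1 ` X"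
  define X2 where "X2 = g2 ` X1"
  define X3 where "X3 = g3 ` X2"
  define X4 where "X4 = g4 ` X3"
  have XM: "X1 \<subseteq> M" "X2 \<subseteq> M" "X3 \<subseteq> M" "X4 \<subseteq> M"
    using X by (auto simp: X1_def X2_def X3_def X4_def)
  have Xfin: "finite X1" "finite X2" "finite X3" "finite X4" "X1 \<noteq> {}" "X2 \<noteq> {}" "X3 \<noteq> {}" "X4 \<noteq> {}"
    using X by (auto simp: X1_def X2_def X3_def X4_def)
  have xM: "x \<in> M" if "x \<in> X" for x using X that by auto
  have c: "chain g k 1 x = g1 x" "chain g k 2 x = g2 (g1 x)" "chain g k 3 x = g3 (g2 (g1 x))"
    "chain g k 4 x = g4 (g3 (g2 (g1 x)))" if "x \<in> M" for x
    using that gI k by (simp_all add: eval_nat_numeral g1_def g2_def g3_def g4_def)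
  have cX: "chain g k 1 ` X = X1" "chain g k 2 ` X = X2" "chain g k 3 ` X = X3"
    using c xM by (auto simp: X1_def X2_def X3_def image_image)
  have iX3: "iv g4 ` X4 = X3" using XM by (force simp: X4_def image_image subset_iff)
  have iX2: "iv g3 ` X3 = X2" using XM by (force simp: X3_def image_image subset_iff)
  \<comment> \<open>The first factor is adjusted so that the images of \<open>A\<close> become free
    from the middle set \<open>X2\<close>.\<close>
  obtain s where s: "fixes_on (X \<union> g1 ` X \<union> X2) s"
    "\<And>a b. a \<in> A \<Longrightarrow> b \<in> X2 \<Longrightarrow> via (g1 ` X) (cj s g1 a) b"
    by (rule free_image[of g1 X X2 A])
      (use X XM Xfin A H1 in \<open>auto simp: cX g1_def[symmetric] X1_def[symmetric]\<close>)
  \<comment> \<open>The last factor is treated backwards: its inverse carries the targets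
    \<open>\<psi> y\<close> to positions free from \<open>X2\<close>.\<close>
  obtain t where t: "fixes_on (X4 \<union> iv g4 ` X4 \<union> X2) t"
    "\<And>a b. a \<in> \<psi> ` A \<Longrightarrow> b \<in> X2 \<Longrightarrow> via (iv g4 ` X4) (cj t (iv g4) a) b"
    by (rule free_image[of "iv g4" X4 X2 "\<psi> ` A"])
      (use XM Xfin A H4 \<psi> in \<open>auto simp: cX g4_def[symmetric] iX3\<close>)
  have stI [simp]: "s \<in> Iso" "t \<in> Iso" using s t fixes_onD by blast+
  define h1 where "h1 = cj s g1"
  define h4 where "h4 = cj t g4"
  have hI [simp]: "h1 \<in> Iso" "h4 \<in> Iso" by (simp_all add: h1_def h4_def)
  have ivh4: "iv h4 = cj t (iv g4)" by (simp add: h4_def iv_cj)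
  define A1 where "A1 = h1 ` A"
  define A3 where "A3 = iv h4 ` \<psi> ` A"
  have A13: "finite A1" "A1 \<subseteq> M" "finite A3" "A3 \<subseteq> M" using A \<psi> by (auto simp: A1_def A3_def)
  have A1X2: "via X1 a b" if "a \<in> A1" "b \<in> X2" for a b
    using that s(2) by (auto simp: A1_def h1_def X1_def)
  have A3X2: "via X3 a b" if "a \<in> A3" "b \<in> X2" for a b
    using that t(2) by (auto simp: A3_def ivh4 iX3)
  \<comment> \<open>The middle images must be free over \<open>X2\<close> from the data on both
    sides, because the second factor reaches them forwards and the third one backwards.\<close>
  obtain m where m: "fixes_on X2 m"
    "\<And>x w. x \<in> g2 ` A1 \<Longrightarrow> w \<in> X1 \<union> A1 \<union> X3 \<union> A3 \<Longrightarrow> via X2 (m x) w"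
    by (rule free_set[of "{}" X2 "X1 \<union> A1 \<union> X3 \<union> A3" "g2 ` A1"]) (use Xfin XM A13 in auto)
  have mI [simp]: "m \<in> Iso" using m fixes_onD by blast
  define \<theta> where "\<theta> = m \<star> g2"
  have \<theta>I [simp]: "\<theta> \<in> Iso" by (simp add: \<theta>_def)
  have \<theta>X1: "\<theta> x = g2 x" if "x \<in> X1" for x
    using that XM fixes_onD(2)[OF m(1)] by (auto simp: \<theta>_def X2_def)
  have \<theta>A1: "via X2 (\<theta> a) w" if "a \<in> A1" "w \<in> X1 \<union> A1 \<union> X3 \<union> A3" for a w
    using m(2)[of "g2 a" w] that A13 by (auto simp: \<theta>_def)
  obtain s2 where s2: "fixes_on (X1 \<union> g2 ` X1) s2" "\<And>a. a \<in> A1 \<Longrightarrow> s2 (g2 (iv s2 a)) = \<theta> a"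
    by (rule conjugate_realises[OF ub(1) Xfin(1) Xfin(5) XM(1) \<theta>I \<theta>X1 A13(1,2)])
      (use A1X2 \<theta>A1 in \<open>auto simp: X2_def\<close>)
  \<comment> \<open>Solved from the requirement that \<open>h1\<close>, \<open>\<theta>\<close>, the
    inverse of \<open>\<theta>'\<close> and \<open>h4\<close>, applied in this order, compose to
    \<open>\<psi>\<close>.\<close>
  define \<theta>' where "\<theta>' = \<theta> \<star> h1 \<star> iv \<psi> \<star> h4"
  have \<theta>'I: "\<theta>' \<in> Iso" using \<psi> by (simp add: \<theta>'_def)
  have \<theta>'X3: "\<theta>' x = iv g3 x" if x: "x \<in> X3" for x
  proof -
    obtain x0 where x0: "x0 \<in> X" "x = g3 (g2 (g1 x0))"
      using x by (auto simp: X3_def X2_def X1_def)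
    have x0M: "x0 \<in> M" using x0 X by auto
    have x1: "g1 x0 \<in> X1" using x0 by (auto simp: X1_def)
    have g4x: "g4 x \<in> X4" using x by (auto simp: X4_def)
    have xM: "x \<in> M" using x XM by auto
    have "iv t x = x" by (rule fixes_on_iv_app[OF t(1)]) (use x xM iX3 in auto)
    then have "h4 x = t (g4 x)" using xM by (simp add: h4_def)
    also have "\<dots> = g4 x" using fixes_onD(2)[OF t(1)] g4x by blast
    also have "\<dots> = \<psi> x0" using \<psi>(2) x0 c(4)[OF x0M] by simp
    finally have "iv \<psi> (h4 x) = x0" using \<psi>(1) x0M by simp
    moreover have "h1 x0 = g1 x0"
    proof -
      have "iv s x0 = x0" by (rule fixes_on_iv_app[OF s(1)]) (use x0 x0M in auto)
      moreover have "s (g1 x0) = g1 x0" using fixes_onD(2)[OF s(1)] x0 by blast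
      ultimately show ?thesis using x0M by (simp add: h1_def)
    qed
    ultimately show ?thesis
      using \<theta>X1[OF x1] x0 x0M xM \<psi>(1) by (simp add: \<theta>'_def)
  qed
  have \<theta>'A3: "\<theta>' (iv h4 (\<psi> y)) = \<theta> (h1 y)" if "y \<in> M" for y
    using that \<psi>(1) by (simp add: \<theta>'_def)
  obtain s3 where s3: "fixes_on (X3 \<union> iv g3 ` X3) s3"
    "\<And>a. a \<in> A3 \<Longrightarrow> s3 (iv g3 (iv s3 a)) = \<theta>' a"
  \<comment> \<open>Applied to the inverse of the third factor, which runs from \<open>X3\<close>
    back to \<open>X2\<close>.\<close>
  proof (rule conjugate_realises[OF unbounded_iv[OF ub(2)] Xfin(3) Xfin(7) XM(3) \<theta>'I \<theta>'X3 A13(3,4)])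
    fix a x assume "a \<in> A3" "x \<in> X3 \<union> A3"
    then show "via (iv g3 ` X3) (\<theta>' a) x"
      using \<theta>A1 \<theta>'A3 A unfolding iX2 by (auto simp: A3_def A1_def)
  qed (use A3X2 iX2 in auto)
  have sI [simp]: "s2 \<in> Iso" "s3 \<in> Iso" using s2 s3 fixes_onD by blast+
  define k' where "k' = k(0 := s \<star> k 0, 1 := s2 \<star> k 1, 2 := s3 \<star> k 2, 3 := t \<star> k 3)"
  have k'I: "k' i \<in> Iso" for i using k by (simp add: k'_def)
  have k'g: "cj (k' 0) g = h1" "cj (k' 1) g = cj s2 g2" "cj (k' 2) g = cj s3 g3" "cj (k' 3) g = h4"
    using k gI by (simp_all add: k'_def cj_mul h1_def h4_def g1_def g2_def g3_def g4_def)
  have "agree g k X k'"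
    unfolding agree_def less_4
  proof (intro conjI ballI; elim insertE emptyE; hypsubst)
    fix x assume x: "x \<in> X"
    have p: "x \<in> M" "g1 x \<in> X1" "g2 (g1 x) \<in> X2" "g3 (g2 (g1 x)) \<in> X3" "g4 (g3 (g2 (g1 x))) \<in> X4"
      using x X by (auto simp: X1_def X2_def X3_def X4_def)
    have q: "chain g k 0 x = x" "chain g k (Suc 0) x = g1 x" "chain g k (Suc (Suc 0)) x = g2 (g1 x)"
       "chain g k (Suc (Suc (Suc 0))) x = g3 (g2 (g1 x))"
       "chain g k (Suc (Suc (Suc (Suc 0)))) x = g4 (g3 (g2 (g1 x)))"
      using c p(1) by (simp_all add: eval_nat_numeral)
    note i = iv_mul_fix[OF s(1) k] iv_mul_fix[OF s2(1) k] iv_mul_fix[OF s3(1) k] iv_mul_fix[OF t(1) k]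
    have k'_i: "k' 0 = s \<star> k 0" "k' (Suc 0) = s2 \<star> k 1" "k' (Suc (Suc 0)) = s3 \<star> k 2"
      "k' (Suc (Suc (Suc 0))) = t \<star> k 3"
      by (simp_all add: k'_def)
    have "iv (s \<star> k 0) x = iv (k 0) x" "iv (s \<star> k 0) (g1 x) = iv (k 0) (g1 x)"
      using i(1)[of _ 0] p x by auto
    moreover have "iv (s2 \<star> k 1) (g1 x) = iv (k 1) (g1 x)"
      "iv (s2 \<star> k 1) (g2 (g1 x)) = iv (k 1) (g2 (g1 x))"
      using i(2)[of _ 1] p x by (auto simp: X2_def)
    moreover have "iv (s3 \<star> k 2) (g2 (g1 x)) = iv (k 2) (g2 (g1 x))"
      "iv (s3 \<star> k 2) (g3 (g2 (g1 x))) = iv (k 2) (g3 (g2 (g1 x)))"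
      using i(3)[of _ 2] p x by (auto simp: iX2)
    moreover have "iv (t \<star> k 3) (g3 (g2 (g1 x))) = iv (k 3) (g3 (g2 (g1 x)))"
      "iv (t \<star> k 3) (g4 (g3 (g2 (g1 x)))) = iv (k 3) (g4 (g3 (g2 (g1 x))))"
      using i(4)[of _ 3] p x by (auto simp: iX3)
    ultimately show
      "iv (k' 0) (chain g k 0 x) = iv (k 0) (chain g k 0 x)"
      "iv (k' 0) (chain g k (Suc 0) x) = iv (k 0) (chain g k (Suc 0) x)"
      "iv (k' (Suc 0)) (chain g k (Suc 0) x) = iv (k (Suc 0)) (chain g k (Suc 0) x)"
      "iv (k' (Suc 0)) (chain g k (Suc (Suc 0)) x) = iv (k (Suc 0)) (chain g k (Suc (Suc 0)) x)"
      "iv (k' (Suc (Suc 0))) (chain g k (Suc (Suc 0)) x)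
        = iv (k (Suc (Suc 0))) (chain g k (Suc (Suc 0)) x)"
      "iv (k' (Suc (Suc 0))) (chain g k (Suc (Suc (Suc 0))) x)
        = iv (k (Suc (Suc 0))) (chain g k (Suc (Suc (Suc 0))) x)"
      "iv (k' (Suc (Suc (Suc 0)))) (chain g k (Suc (Suc (Suc 0))) x)
        = iv (k (Suc (Suc (Suc 0)))) (chain g k (Suc (Suc (Suc 0))) x)"
      "iv (k' (Suc (Suc (Suc 0)))) (chain g k (Suc (Suc (Suc (Suc 0)))) x)
        = iv (k (Suc (Suc (Suc 0)))) (chain g k (Suc (Suc (Suc (Suc 0)))) x)"
      unfolding q k'_i by (simp_all add: eval_nat_numeral)
  qed
  moreover have "chain g k' 4 y = \<psi> y" if y: "y \<in> A" for y
  proof -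
    have yM: "y \<in> M" using y A by auto
    have "cj s2 g2 (h1 y) = \<theta> (h1 y)"
      using s2(2)[of "h1 y"] y yM by (simp add: A1_def)
    moreover have "cj s3 g3 (\<theta> (h1 y)) = iv h4 (\<psi> y)"
    proof -
      have "s3 (iv g3 (iv s3 (iv h4 (\<psi> y)))) = \<theta> (h1 y)"
        using s3(2)[of "iv h4 (\<psi> y)"] y \<theta>'A3[OF yM] by (simp add: A3_def)
      from this[symmetric] show ?thesis using yM \<psi>(1) by simp
    qed
    ultimately show ?thesis using yM \<psi>(1)
      unfolding chain_4 k'g by simp
  qed
  ultimately show "\<exists>k'. (\<forall>i. k' i \<in> Iso) \<and> agree g k X k' \<and> (\<forall>x\<in>A. chain g k' 4 x = \<psi> x)"
    using k'I by blast
qed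

text \<open>
  After conjugating the two inner isometries by an element fixing \<open>E\<close>, the new points of the
  chain are independent over \<open>E\<close> from their images under the outer ones, and \<open>E\<close> is contained
  in both the second and the fourth set of the enlarged chain.
\<close>

lemma flexible_extension:
  assumes g: "unbounded g" and k: "\<And>i. k i \<in> Iso" and X: "finite X" "X \<noteq> {}" "X \<subseteq> M"
  obtains k' Y where "\<forall>i. k' i \<in> Iso" "agree g k X k'" "finite Y" "X \<subseteq> Y" "Y \<subseteq> M" "flexible g k' Y"
proof -
  have gI: "g \<in> Iso" using g by simp
  define g1 where "g1 = cj (k 0) g"
  define g2 where "g2 = cj (k 1) g"
  define g3 where "g3 = cj (k 2) g"
  define g4 where "g4 = cj (k 3) g"
  have gs [simp]: "g1 \<in> Iso" "g2 \<in> Iso" "g3 \<in> Iso" "g4 \<in> Iso"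
    using gI k by (simp_all add: g1_def g2_def g3_def g4_def)
  have xM: "x \<in> M" if "x \<in> X" for x using X that by auto
  \<comment> \<open>These are all positions before and after the two inner factors on
    \<open>X\<close>; an element fixing them can alter those factors without touching frozen
    data.\<close>
  define E where "E = g1 ` X \<union> g2 ` g1 ` X \<union> g3 ` g2 ` g1 ` X"
  have E: "finite E" "E \<noteq> {}" "E \<subseteq> M" using X by (auto simp: E_def)
  define F where "F = g2 ` E \<union> iv g3 ` E \<union> iv g2 ` iv g3 ` E \<union> g3 ` g2 ` E"
  have F: "finite F" "F \<subseteq> M" using E by (auto simp: F_def)
  have "jointly_unbounded {g1, iv g4}"
    unfolding g1_def g4_def by (intro jointly_unbounded_pair unbounded_iv unbounded_cj g k)
  then obtain s where s: "fixes_on E s"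
    "\<And>x w. x \<in> F \<Longrightarrow> w \<in> g1 ` E \<union> iv g4 ` E \<Longrightarrow> via E (s x) w"
    "\<And>x y f. x \<in> F \<Longrightarrow> y \<in> F \<Longrightarrow> f \<in> {g1, iv g4} \<Longrightarrow> via E (s x) (f (s y))"
    using free_set[of "{g1, iv g4}" E "g1 ` E \<union> iv g4 ` E" F] E F by auto
  have sI [simp]: "s \<in> Iso" using s fixes_onD by blast
  define k' where "k' = k(1 := s \<star> k 1, 2 := s \<star> k 2)"
  have k'I: "k' i \<in> Iso" for i using k by (simp add: k'_def)
  have k'g: "cj (k' 0) g = g1" "cj (k' 1) g = cj s g2" "cj (k' 2) g = cj s g3" "cj (k' 3) g = g4"
    using k gI by (simp_all add: k'_def cj_mul g1_def g2_def g3_def g4_def)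
  \<comment> \<open>The points added to \<open>E\<close> are those that the two conjugated inner
    factors carry back onto \<open>E\<close>. Thus \<open>E\<close> appears in the second set and
    again in the fourth.\<close>
  define Y where "Y = iv g1 ` (E \<union> s ` iv g2 ` iv g3 ` E)"
  have Y: "finite Y" "Y \<subseteq> M" using E by (auto simp: Y_def)
  have EM: "e \<in> M" if "e \<in> E" for e using E that by auto
  have sE: "s e = e" "iv s e = e" if "e \<in> E" for e
    using that fixes_onD(2)[OF s(1)] fixes_on_iv_app[OF s(1)] EM by auto
  have c': "chain g k' 1 x = g1 x" "chain g k' 2 x = cj s g2 (g1 x)"
    "chain g k' 3 x = cj s g3 (cj s g2 (g1 x))" if "x \<in> M" for x
    using that gI k'I k'g by (simp_all add: eval_nat_numeral)
  have c: "chain g k 1 x = g1 x" "chain g k 2 x = g2 (g1 x)" "chain g k 3 x = g3 (g2 (g1 x))"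
    if "x \<in> M" for x
    using that gI k by (simp_all add: eval_nat_numeral g1_def g2_def g3_def)
  have Y1: "chain g k' 1 ` Y = E \<union> s ` iv g2 ` iv g3 ` E"
  proof -
    have "chain g k' 1 ` Y = g1 ` Y" using c' Y by (intro image_cong) auto
    also have "\<dots> = (\<lambda>x. x) ` (E \<union> s ` iv g2 ` iv g3 ` E)"
      unfolding Y_def image_image[of g1] by (intro image_cong refl) (use EM in auto)
    finally show ?thesis by simp
  qed
  have Y2: "chain g k' 2 ` Y = s ` g2 ` E \<union> s ` iv g3 ` E"
  proof -
    have "chain g k' 2 ` Y = cj s g2 ` chain g k' 1 ` Y"
      unfolding image_image using c' Y by (intro image_cong) auto
    also have "\<dots> = (\<lambda>x. s (g2 x)) ` E \<union> (\<lambda>x. s (iv g3 x)) ` E"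
      unfolding Y1 image_Un image_image
      by (intro arg_cong2[where f = "(\<union>)"] image_cong refl) (use EM sE in auto)
    finally show ?thesis by (simp add: image_image)
  qed
  have Y3: "chain g k' 3 ` Y = s ` g3 ` g2 ` E \<union> E"
  proof -
    have "chain g k' 3 ` Y = cj s g3 ` chain g k' 2 ` Y"
      unfolding image_image using c' Y by (intro image_cong) auto
    also have "\<dots> = (\<lambda>x. s (g3 (g2 x))) ` E \<union> (\<lambda>x. x) ` E"
      unfolding Y2 image_Un image_image
      by (intro arg_cong2[where f = "(\<union>)"] image_cong refl) (use EM sE in auto)
    finally show ?thesis by (simp add: image_image)
  qed
  have key: "via E (f a) b" if "f \<in> {g1, iv g4}" "a \<in> E \<union> s ` F" "b \<in> s ` F" for f a b
    using that s(2,3) by (auto simp: via_sym[of E "g1 _"] via_sym[of E "iv g4 _"])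
  have "X \<subseteq> Y"
  proof
    fix x assume x: "x \<in> X"
    then have "g1 x \<in> E" by (auto simp: E_def)
    then have "iv g1 (g1 x) \<in> Y" unfolding Y_def by blast
    then show "x \<in> Y" using xM[OF x] by simp
  qed
  moreover have "flexible g k' Y"
  proof (rule flexibleI[OF g k'I Y(1) _ Y(2)])
    show "Y \<noteq> {}" using \<open>X \<subseteq> Y\<close> X by auto
    fix a b assume b: "b \<in> chain g k' 2 ` Y"
    then have bF: "b \<in> s ` F" unfolding Y2 F_def by blast
    show "via (chain g k' 1 ` Y) (cj (k' 0) g a) b" if a: "a \<in> chain g k' 1 ` Y \<union> chain g k' 2 ` Y"
    proof -
      have "a \<in> E \<union> s ` F" using a unfolding Y1 Y2 F_def by blast
      then have "via E (g1 a) b" using key bF by blast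
      then show ?thesis unfolding k'g Y1 by (rule via_mono) blast
    qed
    show "via (chain g k' 3 ` Y) (iv (cj (k' 3) g) a) b"
      if a: "a \<in> chain g k' 3 ` Y \<union> chain g k' 2 ` Y"
    proof -
      have "a \<in> E \<union> s ` F" using a unfolding Y3 Y2 F_def by blast
      then have "via E (iv g4 a) b" using key bF by blast
      then show ?thesis unfolding k'g Y3 by (rule via_mono) blast
    qed
  qed
  moreover have "agree g k X k'"
  proof -
    have moved: "iv (k' i) y = iv (k i) y" if i: "i = 1 \<or> i = 2" and y: "y \<in> E" for i y
      using i iv_mul_fix[OF s(1) k y EM[OF y]] by (auto simp: k'_def)
    have pos: "chain g k j x \<in> E" if "j \<in> {1, 2, 3}" "x \<in> X" for j x
      using that c[OF xM[OF that(2)]] by (auto simp: E_def)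
    have "iv (k' i) y = iv (k i) y"
      if x: "x \<in> X" and y: "y \<in> {chain g k i x, chain g k (Suc i) x}" for i x y
    proof (cases "i = 1 \<or> i = 2")
      case True
      then have "i \<in> {1, 2, 3}" "Suc i \<in> {1, 2, 3}" by auto
      then have "y \<in> E" using pos x y by blast
      then show ?thesis using moved True by blast
    next
      case False
      then show ?thesis by (auto simp: k'_def)
    qed
    then show ?thesis unfolding agree_def by blast
  qed
  ultimately show thesis using that[of k' Y] k'I Y by simp
qed

section \<open>Back-and-forth steps\<close>

text \<open>In the limit each \<open>iv (k i)\<close> needs a dense set of frozen arguments and a
  dense set of frozen values; the two conjuncts put \<open>z\<close> into both. For
  \<open>i = 0\<close> the first one also puts \<open>z\<close> into \<open>X\<close>.\<close>

definition covers :: "('a \<Rightarrow> 'a) \<Rightarrow> (nat \<Rightarrow> 'a \<Rightarrow> 'a) \<Rightarrow> 'a set \<Rightarrow> 'a \<Rightarrow> bool"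
  where "covers g k X z \<longleftrightarrow>
    (\<forall>i<4. z \<in> chain g k i ` X \<and> z \<in> (\<lambda>x. iv (k i) (chain g k i x)) ` X)"

lemma covers_agree:
  assumes "g \<in> Iso" "\<And>i. k i \<in> Iso" "\<And>i. k' i \<in> Iso" "agree g k X k'" "X \<subseteq> X'" "X \<subseteq> M"
    and "covers g k X z"
  shows "covers g k' X' z"
proof -
  have "z \<in> chain g k' i ` X' \<and> z \<in> (\<lambda>x. iv (k' i) (chain g k' i x)) ` X'" if i: "i < 4" for i
  proof -
    obtain x y where x: "x \<in> X" "z = chain g k i x" and y: "y \<in> X" "z = iv (k i) (chain g k i y)"
      using assms(7) i unfolding covers_def by blast
    have c: "chain g k' i x = chain g k i x" "chain g k' i y = chain g k i y"
      using i x y by (intro agree_chain[OF assms(1-4)] assms; simp)+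
    have "iv (k' i) (chain g k i y) = iv (k i) (chain g k i y)"
      using assms(4) i y unfolding agree_def by blast
    then have "z = iv (k' i) (chain g k' i y)" using y c by simp
    moreover have "z = chain g k' i x" using x c by simp
    moreover have "x \<in> X'" "y \<in> X'" using x y assms(5) by auto
    ultimately show ?thesis by (intro conjI) (rule image_eqI; assumption)+
  qed
  then show ?thesis by (simp add: covers_def)
qed

lemma covers_exists:
  assumes "g \<in> Iso" "\<And>i. k i \<in> Iso" "z \<in> M"
  obtains X where "finite X" "X \<subseteq> M" "covers g k X z"
proof -
  define X where "X = (\<lambda>i. iv (chain g k i) z) ` {..<4} \<union> (\<lambda>i. iv (chain g k i) (k i z)) ` {..<4}"
  have "z \<in> chain g k i ` X \<and> z \<in> (\<lambda>x. iv (k i) (chain g k i x)) ` X" if i: "i < 4" for i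
  proof
    show "z \<in> chain g k i ` X"
      by (rule image_eqI[of _ _ "iv (chain g k i) z"]) (use i assms in \<open>auto simp: X_def\<close>)
    show "z \<in> (\<lambda>x. iv (k i) (chain g k i x)) ` X"
      by (rule image_eqI[of _ _ "iv (chain g k i) (k i z)"]) (use i assms in \<open>auto simp: X_def\<close>)
  qed
  then have "covers g k X z" by (simp add: covers_def)
  moreover have "finite X" "X \<subseteq> M" using assms by (auto simp: X_def)
  ultimately show thesis using that by blast
qed

text \<open>First the \<open>g'\<close> side is extended to a flexible set \<open>Y\<close> covering
  \<open>z\<close>. Flexibility of the \<open>g\<close> side on \<open>X\<close> then lets it catch
  up with the new values on all of \<open>Y\<close>. Flexibility thereby passes from one side to the
  other.\<close>

lemma half_step:
  assumes g: "unbounded g" and g': "unbounded g'" and h: "h \<in> Iso"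
    and k: "\<And>i. k i \<in> Iso" and k': "\<And>i. k' i \<in> Iso" and X: "finite X" "X \<noteq> {}" "X \<subseteq> M"
    and gd: "flexible g k X" and eq: "\<And>x. x \<in> X \<Longrightarrow> chain g k 4 x = h (chain g' k' 4 x)"
    and z: "z \<in> M"
  obtains m m' Y where "\<forall>i. m i \<in> Iso" "\<forall>i. m' i \<in> Iso" "finite Y" "X \<subseteq> Y" "Y \<subseteq> M"
    "flexible g' m' Y" "\<forall>x\<in>Y. chain g m 4 x = h (chain g' m' 4 x)"
    "agree g k X m" "agree g' k' X m'" "covers g' m' Y z"
proof -
  have gI: "g \<in> Iso" "g' \<in> Iso" using g g' by simp_all
  obtain C where C: "finite C" "C \<subseteq> M" "covers g' k' C z"
    by (rule covers_exists[OF gI(2) k' z])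
  obtain m' Y where m'': "\<forall>i. m' i \<in> Iso" "agree g' k' (X \<union> C) m'"
    and Y: "finite Y" "X \<union> C \<subseteq> Y" "Y \<subseteq> M" and gd': "flexible g' m' Y"
    using flexible_extension[of g' k' "X \<union> C"] g' k' X C by auto
  have m': "m' i \<in> Iso" "agree g' k' (X \<union> C) m'" for i using m'' by auto
  have XC: "X \<union> C \<subseteq> M" using X C by auto
  \<comment> \<open>This is an admissible target for flexibility on \<open>X\<close>, since
    \<open>m'\<close> leaves the chain of \<open>g'\<close> unchanged there.\<close>
  define \<psi> where "\<psi> = h \<star> chain g' m' 4"
  have \<psi>: "\<psi> \<in> Iso" using h gI m' by (simp add: \<psi>_def)
  have "\<psi> x = chain g k 4 x" if x: "x \<in> X" for x
  proof -
    have "chain g' m' 4 x = chain g' k' 4 x"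
      by (rule agree_chain[OF gI(2) k' m'(1) m'(2)]) (use x XC in auto)
    moreover have "x \<in> M" using x X by auto
    ultimately show ?thesis using eq[OF x] h gI m' by (simp add: \<psi>_def)
  qed
  then have \<psi>X: "\<forall>x\<in>X. \<psi> x = chain g k 4 x" by blast
  obtain m where mm: "\<forall>i. m i \<in> Iso" "agree g k X m" "\<forall>x\<in>Y. chain g m 4 x = \<psi> x"
    using gd[unfolded flexible_def, THEN bspec, OF \<psi>, THEN mp, OF \<psi>X,
      THEN spec, THEN mp, OF Y(1), THEN mp, OF Y(3)] by (elim exE conjE)
  have m: "m i \<in> Iso" "agree g k X m" for i using mm by auto
  have "chain g m 4 x = h (chain g' m' 4 x)" if x: "x \<in> Y" for x
  proof -
    have "x \<in> M" using x Y by auto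
    then show ?thesis using mm(3) x h gI m' by (simp add: \<psi>_def)
  qed
  moreover have "agree g' k' X m'" using m'(2) by (auto simp: agree_def)
  moreover have "covers g' m' Y z"
  proof (rule covers_agree[OF gI(2) k' m'(1) _ _ C(2,3)])
    show "agree g' k' C m'" using m'(2) by (auto simp: agree_def)
  qed (use Y in auto)
  ultimately show thesis using that[of m m' Y] m m' Y gd' by blast
qed

text \<open>Two half steps, the second with the sides exchanged and \<open>h\<close> replaced by its
  inverse, return flexibility to the \<open>g\<close> side.\<close>

lemma full_step:
  assumes g: "unbounded g" and g': "unbounded g'" and h: "h \<in> Iso"
    and k: "\<And>i. k i \<in> Iso" and k': "\<And>i. k' i \<in> Iso" and X: "finite X" "X \<noteq> {}" "X \<subseteq> M"
    and gd: "flexible g k X" and eq: "\<And>x. x \<in> X \<Longrightarrow> chain g k 4 x = h (chain g' k' 4 x)"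
    and z: "z \<in> M"
  obtains m m' Y where "\<forall>i. m i \<in> Iso" "\<forall>i. m' i \<in> Iso" "finite Y" "X \<subseteq> Y" "Y \<subseteq> M"
    "flexible g m Y" "\<forall>x\<in>Y. chain g m 4 x = h (chain g' m' 4 x)"
    "agree g k X m" "agree g' k' X m'" "covers g m Y z" "covers g' m' Y z"
proof -
  have gI: "g \<in> Iso" "g' \<in> Iso" using g g' by simp_all
  obtain m m' Y where m': "\<forall>i. m i \<in> Iso" "\<forall>i. m' i \<in> Iso" and Y: "finite Y" "X \<subseteq> Y" "Y \<subseteq> M"
    and gd': "flexible g' m' Y" and eq: "\<forall>x\<in>Y. chain g m 4 x = h (chain g' m' 4 x)"
    and ag: "agree g k X m" "agree g' k' X m'" and cov: "covers g' m' Y z"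
    by (rule half_step[OF g g' h k k' X gd eq z])
  have m: "m i \<in> Iso" "m' i \<in> Iso" for i using m' by auto
  have eq'': "chain g' m' 4 x = iv h (chain g m 4 x)" if "x \<in> Y" for x
    using eq that Y h gI m by (auto simp: subset_iff)
  have "Y \<noteq> {}" using X Y by auto
  then obtain n' n Z where n': "\<forall>i. n' i \<in> Iso" "\<forall>i. n i \<in> Iso" and Z: "finite Z" "Y \<subseteq> Z" "Z \<subseteq> M"
    and gdn: "flexible g n Z" and eqn: "\<forall>x\<in>Z. chain g' n' 4 x = iv h (chain g n 4 x)"
    and agn: "agree g' m' Y n'" "agree g m Y n" and covn: "covers g n Z z"
    by (rule half_step[OF g' g iso_iv[OF h] m(2) m(1) Y(1) _ Y(3) gd' eq'' z])
  have n: "n i \<in> Iso" "n' i \<in> Iso" for i using n' by auto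
  have "chain g n 4 x = h (chain g' n' 4 x)" if "x \<in> Z" for x
    using eqn that Z h gI n by (auto simp: subset_iff)
  moreover have "agree g k X n"
    by (rule agree_trans[OF gI(1) k m(1) ag(1) agn(2) Y(2) X(3)])
  moreover have "agree g' k' X n'"
    by (rule agree_trans[OF gI(2) k' m(2) ag(2) agn(1) Y(2) X(3)])
  moreover have "covers g' n' Z z"
    by (rule covers_agree[OF gI(2) m(2) n(2) agn(1) Z(2) Y(3) cov])
  ultimately show thesis using that[of n n' Z] n Z Y gdn covn by blast
qed

subsection \<open>Limits of isometries\<close>

lemma dense_sequence:
  obtains z :: "nat \<Rightarrow> 'a" where "\<And>n. z n \<in> M" "\<And>x e. x \<in> M \<Longrightarrow> 0 < e \<Longrightarrow> \<exists>n. d x (z n) < e"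
proof -
  obtain C where C: "countable C" "C \<subseteq> M" "mtopology closure_of C = M"
    using separable by (auto simp: separable_space_def)
  have ne: "C \<noteq> {}" using C M_nonempty by auto
  have "\<exists>n. d x (from_nat_into C n) < e" if "x \<in> M" "0 < e" for x e
  proof -
    have "x \<in> mtopology closure_of C" using C that by simp
    then have "\<forall>r>0. \<exists>y\<in>C. y \<in> mball x r" by (simp add: metric_closure_of del: in_mball)
    then have "\<exists>y\<in>C. y \<in> mball x e" using that(2) by blast
    then obtain y where "y \<in> C" "d x y < e" by auto
    then show ?thesis using from_nat_into_surj[OF C(1)] by metis
  qed
  then show thesis using that[of "from_nat_into C"] C(2) from_nat_into[OF ne] by blast
qed

text \<open>Isometries transport closeness: if the values at a nearby point are eventually constant,
  those at \<open>x\<close> eventually stay within twice the distance of the two points, so they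
  form a Cauchy sequence.\<close>

lemma pointwise_limit:
  fixes f :: "nat \<Rightarrow> 'a \<Rightarrow> 'a"
  assumes f: "\<And>n. f n \<in> Iso" and x: "x \<in> M"
    and st: "\<And>e. 0 < e \<Longrightarrow> \<exists>y\<in>M. d x y < e \<and> (\<exists>N. \<forall>n\<ge>N. f n y = f N y)"
  shows "\<exists>l\<in>M. \<forall>e>0. \<exists>N. \<forall>n\<ge>N. d (f n x) l < e"
proof -
  have "MCauchy (\<lambda>n. f n x)"
    unfolding MCauchy_def
  proof (intro conjI allI impI)
    show "range (\<lambda>n. f n x) \<subseteq> M" using f x by auto
    fix e :: real assume "0 < e"
    then obtain y N where y: "y \<in> M" "d x y < e / 2" "\<forall>n\<ge>N. f n y = f N y"
      using st[of "e / 2"] by auto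
    have "d (f n x) (f n' x) < e" if "N \<le> n" "N \<le> n'" for n n'
    proof -
      have "d (f n x) (f n' x) \<le> d (f n x) (f n y) + d (f n y) (f n' x)"
        by (rule triangle) (use f x y in auto)
      moreover have "f n y = f n' y" using y(3) that by metis
      moreover have "d (f n x) (f n y) = d x y" "d (f n' y) (f n' x) = d x y"
        using f x y(1) commute[of y x] by simp_all
      ultimately show ?thesis using y(2) by simp
    qed
    then show "\<exists>N. \<forall>n n'. N \<le> n \<longrightarrow> N \<le> n' \<longrightarrow> d (f n x) (f n' x) < e" by blast
  qed
  then obtain l where "limitin mtopology (\<lambda>n. f n x) l sequentially"
    using complete unfolding mcomplete_def by blast
  then have "l \<in> M \<and> (\<forall>e>0. \<exists>N. \<forall>n\<ge>N. f n x \<in> M \<and> d (f n x) l < e)"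
    by (simp add: limit_metric_sequentially)
  then show ?thesis by blast
qed

text \<open>By \<open>dense\<close> the isometries converge pointwise. By \<open>dense'\<close> the
  images of stable points are dense, and the inverses are eventually constant on them; so the
  inverses converge as well and the limit is onto.\<close>

lemma iso_limit:
  assumes m: "\<And>n. m n \<in> Iso" and A: "\<And>n. A n \<subseteq> M" and mono: "\<And>n. A n \<subseteq> A (Suc n)"
    and ag: "\<And>n x. x \<in> A n \<Longrightarrow> m (Suc n) x = m n x"
    and dense: "\<And>x e. x \<in> M \<Longrightarrow> 0 < e \<Longrightarrow> \<exists>n. \<exists>y\<in>A n. d x y < e"
    and dense': "\<And>x e. x \<in> M \<Longrightarrow> 0 < e \<Longrightarrow> \<exists>n. \<exists>y\<in>A n. d x (m n y) < e"
  obtains l where "l \<in> Iso" "\<And>n x. x \<in> A n \<Longrightarrow> l x = m n x"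
proof -
  have mono': "A n \<subseteq> A p" if "n \<le> p" for n p
    using lift_Suc_mono_le[of A, OF mono that] .
  have stable: "m p x = m n x" if "n \<le> p" "x \<in> A n" for n p x
    using that(1)
  proof (induction p rule: dec_induct)
    case (step p)
    then show ?case using ag[of x p] mono'[of n p] that(2) by auto
  qed simp
  have "\<exists>l\<in>M. \<forall>e>0. \<exists>N. \<forall>n\<ge>N. d (m n x) l < e" if x: "x \<in> M" for x
  proof (rule pointwise_limit[OF m x])
    fix e :: real assume "0 < e"
    then obtain n y where "y \<in> A n" "d x y < e" using dense[OF x] by blast
    then show "\<exists>y\<in>M. d x y < e \<and> (\<exists>N. \<forall>n\<ge>N. m n y = m N y)"
      using A stable by (intro bexI[of _ y] conjI exI[of _ n]) auto
  qed
  then obtain l where l: "\<And>x. x \<in> M \<Longrightarrow> l x \<in> M"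
    "\<And>x e. x \<in> M \<Longrightarrow> 0 < e \<Longrightarrow> \<exists>N. \<forall>n\<ge>N. d (m n x) (l x) < e"
    by metis
  have "\<exists>l\<in>M. \<forall>e>0. \<exists>N. \<forall>n\<ge>N. d (iv (m n) x) l < e" if x: "x \<in> M" for x
  proof (rule pointwise_limit[of "\<lambda>n. iv (m n)", OF _ x])
    fix e :: real assume "0 < e"
    then obtain n y where y: "y \<in> A n" "d x (m n y) < e" using dense'[OF x] by blast
    have yM: "y \<in> M" using y A by auto
    have "iv (m p) (m n y) = y" if "n \<le> p" for p
      using stable[OF that y(1)] iv_app1[OF m yM, of p] by simp
    then show "\<exists>y\<in>M. d x y < e \<and> (\<exists>N. \<forall>n\<ge>N. iv (m n) y = iv (m N) y)"
      using y m yM by (intro bexI[of _ "m n y"] conjI exI[of _ n]) auto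
  qed (use m in simp)
  then obtain l' where l': "\<And>x. x \<in> M \<Longrightarrow> l' x \<in> M"
    "\<And>x e. x \<in> M \<Longrightarrow> 0 < e \<Longrightarrow> \<exists>N. \<forall>n\<ge>N. d (iv (m n) x) (l' x) < e"
    by metis
  have dist: "d (l x) (l y) = d x y" if xy: "x \<in> M" "y \<in> M" for x y
  proof (rule ccontr)
    assume "d (l x) (l y) \<noteq> d x y"
    define r where "r = \<bar>d (l x) (l y) - d x y\<bar> / 2"
    have pos: "0 < r" using \<open>d (l x) (l y) \<noteq> d x y\<close> by (simp add: r_def)
    obtain N1 N2 where N: "\<forall>n\<ge>N1. d (m n x) (l x) < r" "\<forall>n\<ge>N2. d (m n y) (l y) < r"
      using l(2)[OF xy(1) pos] l(2)[OF xy(2) pos] by blast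
    define n where "n = max N1 N2"
    have "d (m n x) (l x) < r" "d (m n y) (l y) < r" using N by (auto simp: n_def)
    moreover have M: "m n x \<in> M" "m n y \<in> M" "l x \<in> M" "l y \<in> M" using m l xy by auto
    have "d (l x) (l y) \<le> d (l x) (m n x) + d (m n x) (l y)"
      "d (m n x) (l y) \<le> d (m n x) (m n y) + d (m n y) (l y)"
      "d (m n x) (m n y) \<le> d (m n x) (l x) + d (l x) (m n y)"
      "d (l x) (m n y) \<le> d (l x) (l y) + d (l y) (m n y)"
      using M triangle by blast+
    moreover have "d (m n x) (m n y) = d x y" using m xy by simp
    ultimately have "d (l x) (l y) - d x y < 2 * r" "d x y - d (l x) (l y) < 2 * r"
      using commute[of "l x" "m n x"] commute[of "l y" "m n y"] by linarith+
    then show False by (simp add: r_def)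
  qed
  have surj: "l (l' y) = y" if y: "y \<in> M" for y
  proof (rule ccontr)
    assume ne: "l (l' y) \<noteq> y"
    have M: "l' y \<in> M" "l (l' y) \<in> M" using l l' y by auto
    have pos: "0 < d (l (l' y)) y / 2" using ne M y by simp
    obtain N1 N2 where N: "\<forall>n\<ge>N1. d (m n (l' y)) (l (l' y)) < d (l (l' y)) y / 2"
      "\<forall>n\<ge>N2. d (iv (m n) y) (l' y) < d (l (l' y)) y / 2"
      using l(2)[OF M(1) pos] l'(2)[OF y pos] by blast
    define n where "n = max N1 N2"
    have "d (m n (l' y)) (l (l' y)) < d (l (l' y)) y / 2" "d (iv (m n) y) (l' y) < d (l (l' y)) y / 2"
      using N by (auto simp: n_def)
    moreover have "d (l (l' y)) y \<le> d (l (l' y)) (m n (l' y)) + d (m n (l' y)) y"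
      by (rule triangle) (use M m y in auto)
    moreover have "d (m n (l' y)) y = d (iv (m n) y) (l' y)"
      using iso_dist_iv1[OF m M(1) y, of n] commute by simp
    ultimately show False using commute[of "l (l' y)" "m n (l' y)"] by linarith
  qed
  have lA: "l x = m n x" if x: "x \<in> A n" for n x
  proof (rule ccontr)
    assume ne: "l x \<noteq> m n x"
    have xM: "x \<in> M" using x A by auto
    have pos: "0 < d (m n x) (l x)" using ne l m xM by auto
    obtain N where N: "\<forall>p\<ge>N. d (m p x) (l x) < d (m n x) (l x)"
      using l(2)[OF xM pos] by blast
    then have "d (m (max n N) x) (l x) < d (m n x) (l x)" by auto
    then show False using stable[of n "max n N" x] x by simp
  qed
  \<comment> \<open>Elements of \<open>Iso\<close> are required to be undefined outside
    \<open>M\<close>.\<close>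
  define L where "L = restrict l M"
  have "inj_on l M"
    by (intro inj_onI) (metis dist zero)
  moreover have "l ` M = M" using l(1) l'(1) surj by (force simp: image_iff)
  ultimately have "bij_betw L M M" by (simp add: L_def bij_betw_def)
  then have "L \<in> Iso" using dist by (auto simp: isometries_def Bij_def L_def)
  moreover have "L x = m n x" if "x \<in> A n" for n x using lA[OF that] A that by (auto simp: L_def)
  ultimately show thesis using that by blast
qed

lemma iso_eq_dense:
  assumes f: "f \<in> Iso" "g \<in> Iso" and D: "D \<subseteq> M" "\<And>x e. x \<in> M \<Longrightarrow> 0 < e \<Longrightarrow> \<exists>y\<in>D. d x y < e"
    and eq: "\<And>x. x \<in> D \<Longrightarrow> f x = g x"
  shows "f = g"
proof (rule iso_eqI[OF f])
  fix x assume x: "x \<in> M"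
  show "f x = g x"
  proof (rule ccontr)
    assume "f x \<noteq> g x"
    then have "0 < d (f x) (g x) / 2" using f x by simp
    then obtain y where y: "y \<in> D" "d x y < d (f x) (g x) / 2" using D(2)[OF x] by blast
    have yM: "y \<in> M" using y D by auto
    have "d (f x) (g x) \<le> d (f x) (f y) + d (f y) (g x)"
      by (rule triangle) (use f x yM in auto)
    moreover have "d (f x) (f y) = d x y" "d (g y) (g x) = d y x" using f x yM by simp_all
    ultimately have "d (f x) (g x) \<le> d x y + d y x" using eq[OF y(1)] by simp
    then show False using y(2) commute[of x y] by simp
  qed
qed

text \<open>\<open>iso_limit\<close> is applied to the inverse conjugators for each \<open>i\<close>
  separately, with the positions before and after step \<open>i\<close> as stable points.
  \<open>cov\<close> supplies both density conditions.\<close>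

lemma chain_limit:
  assumes g: "g \<in> Iso" and k: "\<And>n i. k n i \<in> Iso" and X: "\<And>n. X n \<subseteq> M"
    and mono: "\<And>n. X n \<subseteq> X (Suc n)" and ag: "\<And>n. agree g (k n) (X n) (k (Suc n))"
    and z: "\<And>x e. x \<in> M \<Longrightarrow> 0 < e \<Longrightarrow> \<exists>n. d x (z n) < e"
    and cov: "\<And>n. covers g (k (Suc n)) (X (Suc n)) (z n)"
  obtains K where "\<forall>i. K i \<in> Iso" "\<forall>n. agree g (k n) (X n) K"
proof -
  have "\<exists>l\<in>Iso. \<forall>n. \<forall>x\<in>X n. \<forall>y\<in>{chain g (k n) i x, chain g (k n) (Suc i) x}. l y = iv (k n i) y"
    if i: "i < 4" for i
  proof -
    define A where "A n = (\<Union>x\<in>X n. {chain g (k n) i x, chain g (k n) (Suc i) x})" for n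
    obtain l where l: "l \<in> Iso" "\<And>n x. x \<in> A n \<Longrightarrow> l x = iv (k n i) x"
    proof (rule iso_limit[of "\<lambda>n. iv (k n i)" A])
      fix n
      show "iv (k n i) \<in> Iso" using k by simp
      have "chain g (k n) j x \<in> M" if "x \<in> X n" for j x
        by (rule iso_in[OF chain_iso[OF g k] subsetD[OF X that]])
      then show "A n \<subseteq> M" unfolding A_def by blast
      have c: "chain g (k (Suc n)) j x = chain g (k n) j x" if "x \<in> X n" "j \<le> 4" for j x
        by (rule agree_chain[of g "k n" "k (Suc n)" "X n"]) (fact g k ag X that)+
      show "A n \<subseteq> A (Suc n)"
        unfolding A_def
      proof (rule UN_mono[OF mono])
        fix x assume "x \<in> X n"
        then show "{chain g (k n) i x, chain g (k n) (Suc i) x}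
          \<subseteq> {chain g (k (Suc n)) i x, chain g (k (Suc n)) (Suc i) x}"
          using c[of x i] c[of x "Suc i"] i by simp
      qed
      show "iv (k (Suc n) i) x = iv (k n i) x" if "x \<in> A n" for x
        using ag[of n] i that unfolding agree_def A_def by blast
    next
      fix x and e :: real assume x: "x \<in> M" "0 < e"
      then obtain n where n: "d x (z n) < e" using z by blast
      have c: "z n \<in> chain g (k (Suc n)) i ` X (Suc n)"
        "z n \<in> (\<lambda>x. iv (k (Suc n) i) (chain g (k (Suc n)) i x)) ` X (Suc n)"
        using cov[of n] i unfolding covers_def by blast+
      have "z n \<in> A (Suc n)" using c(1) by (auto simp: A_def)
      then show "\<exists>n. \<exists>y\<in>A n. d x y < e" using n by blast
      obtain y where "y \<in> A (Suc n)" "z n = iv (k (Suc n) i) y" using c(2) by (auto simp: A_def)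
      then show "\<exists>n. \<exists>y\<in>A n. d x (iv (k n i) y) < e" using n by metis
    qed blast
    have "l y = iv (k n i) y" if "x \<in> X n" "y \<in> {chain g (k n) i x, chain g (k n) (Suc i) x}" for n x y
      by (rule l(2)) (use that in \<open>unfold A_def, blast\<close>)
    then show ?thesis using l(1) by blast
  qed
  then obtain l where l: "\<And>i. i < 4 \<Longrightarrow> l i \<in> Iso"
    "\<And>i n x y. i < 4 \<Longrightarrow> x \<in> X n \<Longrightarrow> y \<in> {chain g (k n) i x, chain g (k n) (Suc i) x} \<Longrightarrow>
      l i y = iv (k n i) y"
    by metis
  \<comment> \<open>\<open>agree\<close> concerns only the indices below 4; the identity is a
    default value for the others.\<close>
  define K where "K i = (if i < 4 then iv (l i) else idm)" for i
  have "agree g (k n) (X n) K" for n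
    unfolding agree_def
  proof (intro allI impI ballI)
    fix i x y assume "i < 4" "x \<in> X n" "y \<in> {chain g (k n) i x, chain g (k n) (Suc i) x}"
    from l(2)[OF this] show "iv (K i) y = iv (k n i) y"
      using l(1)[OF \<open>i < 4\<close>] \<open>i < 4\<close> by (simp add: K_def)
  qed
  moreover have "\<forall>i. K i \<in> Iso" using l(1) by (simp add: K_def)
  ultimately show thesis using that by blast
qed

text \<open>Full steps are iterated along a dense sequence. The limit conjugators keep all frozen
  data, so the two products agree on the union of the finite sets, which is dense.\<close>

lemma back_and_forth:
  assumes g: "unbounded g" and g': "unbounded g'" and h: "h \<in> Iso"
    and k: "\<forall>i. k i \<in> Iso" and k': "\<forall>i. k' i \<in> Iso" and X: "finite X" "X \<noteq> {}" "X \<subseteq> M"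
    and gd: "flexible g k X" and eq: "\<forall>x\<in>X. chain g k 4 x = h (chain g' k' 4 x)"
  obtains K K' where "\<forall>i. K i \<in> Iso" "\<forall>i. K' i \<in> Iso" "chain g K 4 = h \<star> chain g' K' 4"
proof -
  obtain z :: "nat \<Rightarrow> 'a" where z: "\<And>n. z n \<in> M" "\<And>x e. x \<in> M \<Longrightarrow> 0 < e \<Longrightarrow> \<exists>n. d x (z n) < e"
    using dense_sequence by blast
  have gI: "g \<in> Iso" "g' \<in> Iso" using g g' by simp_all
  define P where "P = (\<lambda>n::nat. \<lambda>(k, k', X). (\<forall>i. k i \<in> Iso) \<and> (\<forall>i. k' i \<in> Iso) \<and>
    finite X \<and> X \<noteq> {} \<and> X \<subseteq> M \<and> flexible g k X \<and> (\<forall>x\<in>X. chain g k 4 x = h (chain g' k' 4 x)))"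
  define Q where "Q = (\<lambda>n::nat. \<lambda>(k, k', X) (m, m', Y). X \<subseteq> Y \<and> agree g k X m \<and> agree g' k' X m' \<and>
    covers g m Y (z n) \<and> covers g' m' Y (z n))"
  have "\<exists>s. \<forall>n. P n (s n) \<and> Q n (s n) (s (Suc n))"
  proof (rule dependent_nat_choice)
    show "\<exists>s. P 0 s" using k k' X gd eq by (intro exI[of _ "(k, k', X)"]) (simp add: P_def)
    fix s n assume "P n s"
    obtain k k' X where s: "s = (k, k', X)" by (cases s)
    have p: "k i \<in> Iso" "k' i \<in> Iso" "finite X" "X \<noteq> {}" "X \<subseteq> M" "flexible g k X"
      "x \<in> X \<Longrightarrow> chain g k 4 x = h (chain g' k' 4 x)" for i x
      using \<open>P n s\<close> by (auto simp: P_def s)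
    obtain m m' Y where "\<forall>i. m i \<in> Iso" "\<forall>i. m' i \<in> Iso" "finite Y" "X \<subseteq> Y" "Y \<subseteq> M"
      "flexible g m Y" "\<forall>x\<in>Y. chain g m 4 x = h (chain g' m' 4 x)"
      "agree g k X m" "agree g' k' X m'" "covers g m Y (z n)" "covers g' m' Y (z n)"
      by (rule full_step[of g g' h k k' X "z n"]) (rule g g' h p(1-6) z(1) | erule p(7))+
    then show "\<exists>t. P (Suc n) t \<and> Q n s t"
      using p(4) by (intro exI[of _ "(m, m', Y)"]) (auto simp: P_def Q_def s)
  qed
  then obtain s where s: "\<And>n. P n (s n)" "\<And>n. Q n (s n) (s (Suc n))" by blast
  define kk where "kk n = fst (s n)" for n
  define kk' where "kk' n = fst (snd (s n))" for n
  define XX where "XX n = snd (snd (s n))" for n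
  have sn: "s n = (kk n, kk' n, XX n)" for n by (simp add: kk_def kk'_def XX_def)
  have p: "kk n i \<in> Iso" "kk' n i \<in> Iso" "XX n \<subseteq> M"
    "x \<in> XX n \<Longrightarrow> chain g (kk n) 4 x = h (chain g' (kk' n) 4 x)" for n i x
    using s(1)[of n] unfolding sn P_def by auto
  have q: "XX n \<subseteq> XX (Suc n)" "agree g (kk n) (XX n) (kk (Suc n))"
    "agree g' (kk' n) (XX n) (kk' (Suc n))" "covers g (kk (Suc n)) (XX (Suc n)) (z n)"
    "covers g' (kk' (Suc n)) (XX (Suc n)) (z n)" for n
    using s(2)[of n] unfolding sn Q_def by auto
  obtain K where K: "\<forall>i. K i \<in> Iso" "\<forall>n. agree g (kk n) (XX n) K"
    by (rule chain_limit[of g kk XX z]) (rule gI p(1,3) q(1,2,4) | erule (1) z(2))+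
  obtain K' where K': "\<forall>i. K' i \<in> Iso" "\<forall>n. agree g' (kk' n) (XX n) K'"
    by (rule chain_limit[of g' kk' XX z]) (rule gI p(2,3) q(1,3,5) | erule (1) z(2))+
  have "chain g K 4 = h \<star> chain g' K' 4"
  proof (rule iso_eq_dense[of _ _ "\<Union>n. XX n"])
    show "chain g K 4 \<in> Iso" "h \<star> chain g' K' 4 \<in> Iso" using K K' gI h by auto
    show "(\<Union>n. XX n) \<subseteq> M" using p(3) by blast
    fix x assume "x \<in> (\<Union>n. XX n)"
    then obtain n where n: "x \<in> XX n" by blast
    have "chain g K 4 x = chain g (kk n) 4 x"
      by (rule agree_chain[OF gI(1) p(1) _ _ n p(3)]) (use K in auto)
    moreover have "chain g' K' 4 x = chain g' (kk' n) 4 x"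
      by (rule agree_chain[OF gI(2) p(2) _ _ n p(3)]) (use K' in auto)
    ultimately show "chain g K 4 x = (h \<star> chain g' K' 4) x"
      using p(3)[of n] p(4)[OF n] n h gI K' by auto
  next
    fix x and e :: real assume "x \<in> M" "0 < e"
    then obtain n where n: "d x (z n) < e" using z by blast
    \<comment> \<open>The empty product is the identity, so covering at index 0 says that
      \<open>z n\<close> lies in the set itself.\<close>
    have "z n \<in> chain g (kk (Suc n)) 0 ` XX (Suc n)" using q(4)[of n] unfolding covers_def by fastforce
    then have "z n \<in> XX (Suc n)" using p(3)[of "Suc n"] by auto
    then show "\<exists>y\<in>\<Union>n. XX n. d x y < e" using n by blast
  qed
  then show thesis using that K K' by blast
qed

section \<open>The initial configuration and the eight conjugates\<close>

lemma chain_cj: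
  assumes "g \<in> Iso" "\<And>i. k i \<in> Iso" "m \<in> Iso" "x \<in> M"
  shows "chain g (\<lambda>i. m \<star> k i) i (m x) = m (chain g k i x)"
  using assms
proof (induction i)
  case (Suc i)
  have "chain g k i x \<in> M" using Suc.prems by (simp add: iso_in)
  then show ?case using Suc by (simp add: cj_mul)
qed simp

text \<open>Multiplying all conjugators by \<open>m\<close> transports the chain by
  \<open>m\<close>; the extension problem is pulled back by \<open>iv m\<close>, solved there and
  pushed forward.\<close>

lemma flexible_cj:
  assumes g: "g \<in> Iso" and k: "\<And>i. k i \<in> Iso" and m: "m \<in> Iso" and X: "X \<subseteq> M" and gd: "flexible g k X"
  shows "flexible g (\<lambda>i. m \<star> k i) (m ` X)"
  unfolding flexible_def
proof (intro ballI impI allI)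
  fix \<psi> A
  assume \<psi>: "\<psi> \<in> Iso" "\<forall>x\<in>m ` X. \<psi> x = chain g (\<lambda>i. m \<star> k i) 4 x" and A: "finite A" "A \<subseteq> M"
  have XM: "x \<in> M" if "x \<in> X" for x using X that by auto
  have cM: "chain g k i x \<in> M" if "x \<in> X" for i x using g k XM[OF that] by (simp add: iso_in)
  have 1: "cj (iv m) \<psi> \<in> Iso" using m \<psi> by simp
  have 2: "\<forall>x\<in>X. cj (iv m) \<psi> x = chain g k 4 x"
    using \<psi> m chain_cj[of g k m _ 4] g k XM cM by simp
  have 3: "finite (iv m ` A)" "iv m ` A \<subseteq> M" using A m by auto
  obtain k' where k': "\<forall>i. k' i \<in> Iso" "agree g k X k'" "\<forall>x\<in>iv m ` A. chain g k' 4 x = cj (iv m) \<psi> x"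
    using gd[unfolded flexible_def, THEN bspec, OF 1, THEN mp, OF 2, THEN spec, THEN mp, OF 3(1),
      THEN mp, OF 3(2)] by (elim exE conjE)
  have iv_m: "iv (m \<star> k i) (m y) = iv (k i) y" if "k i \<in> Iso" "y \<in> M" for k :: "nat \<Rightarrow> _" and i y
    using that m by (simp add: isom.inv_mult_group)
  have "agree g (\<lambda>i. m \<star> k i) (m ` X) (\<lambda>i. m \<star> k' i)"
    unfolding agree_def
  proof (intro allI impI ballI)
    fix i x y assume i: "i < 4" and x: "x \<in> m ` X"
      and y: "y \<in> {chain g (\<lambda>i. m \<star> k i) i x, chain g (\<lambda>i. m \<star> k i) (Suc i) x}"
    obtain x' where x': "x' \<in> X" "x = m x'" using x by blast
    obtain y' where y': "y = m y'" "y' \<in> {chain g k i x', chain g k (Suc i) x'}"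
      using y unfolding x'(2) chain_cj[OF g k m XM[OF x'(1)]] by blast
    have "y' \<in> M" using y'(2) cM[OF x'(1)] by (auto simp del: chain.simps)
    moreover have "iv (k' i) y' = iv (k i) y'"
      using k'(2) i x'(1) y'(2) unfolding agree_def by blast
    ultimately show "iv (m \<star> k' i) y = iv (m \<star> k i) y"
      using iv_m k k'(1) y'(1) by simp
  qed
  moreover have "chain g (\<lambda>i. m \<star> k' i) 4 x = \<psi> x" if x: "x \<in> A" for x
  proof -
    have xM: "x \<in> M" using x A by auto
    have "chain g (\<lambda>i. m \<star> k' i) 4 (m (iv m x)) = m (chain g k' 4 (iv m x))"
      by (rule chain_cj) (use g k' m xM in auto)
    also have "\<dots> = m (cj (iv m) \<psi> (iv m x))" using k'(3) x by simp
    finally show ?thesis using xM m \<psi>(1) by simp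
  qed
  ultimately show "\<exists>k'. (\<forall>i. k' i \<in> Iso) \<and> agree g (\<lambda>i. m \<star> k i) (m ` X) k' \<and>
      (\<forall>x\<in>A. chain g k' 4 x = \<psi> x)"
    using k'(1) m by (intro exI[of _ "\<lambda>i. m \<star> k' i"]) simp
qed

text \<open>A constant that bounds all distances within \<open>P\<close> is an admissible distance
  function for a new point; the sum of these distances is such a bound.\<close>

lemma far_point:
  assumes "finite P" "P \<subseteq> M"
  obtains u N where "u \<in> M" "N0 \<le> N" "\<And>x. x \<in> P \<Longrightarrow> d u x = N"
proof -
  define N where "N = \<bar>N0\<bar> + (\<Sum>q\<in>P \<times> P. d (fst q) (snd q))"
  have "0 \<le> (\<Sum>q\<in>P \<times> P. d (fst q) (snd q))" by (simp add: sum_nonneg)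
  then have N: "N0 \<le> N" "0 \<le> N" by (simp_all add: N_def)
  have dN: "d x y \<le> N" if "x \<in> P" "y \<in> P" for x y
    using member_le_sum[of "(x, y)" "P \<times> P" "\<lambda>q. d (fst q) (snd q)"] that assms(1) by (simp add: N_def)
  obtain u where "u \<in> M" "\<And>x r. (x, r) \<in> (\<lambda>x. (x, N)) ` P \<Longrightarrow> d u x = r"
  proof (rule katetov_realise[of "(\<lambda>x. (x, N)) ` P"])
    fix x r y s assume *: "(x, r) \<in> (\<lambda>x. (x, N)) ` P" "(y, s) \<in> (\<lambda>x. (x, N)) ` P"
    then show "r \<le> s + d x y" by auto
    show "d x y \<le> r + s" using * dN[of x y] N by auto
  qed (use assms in auto)
  then show thesis using that[of u N] N by auto
qed

text \<open>This provides the starting data of \<open>back_and_forth\<close>. Flexible sets for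
  \<open>g\<close> and \<open>g'\<close> are found separately, starting from trivial conjugators,
  and the first is moved far away from the second. Flexibility of the \<open>g'\<close> side then
  makes both sides agree on the moved set.\<close>

lemma eight_chain:
  assumes g: "unbounded g" and g': "unbounded g'" and h: "h \<in> Iso"
  obtains K K' where "\<forall>i. K i \<in> Iso" "\<forall>i. K' i \<in> Iso" "chain g K 4 = h \<star> chain g' K' 4"
proof -
  have gI [simp]: "g \<in> Iso" "g' \<in> Iso" using g g' by simp_all
  obtain x0 where x0: "x0 \<in> M" using M_nonempty by blast
  obtain k X where k': "\<forall>i. k i \<in> Iso" "agree g (\<lambda>_. idm) {x0} k"
    and X: "finite X" "{x0} \<subseteq> X" "X \<subseteq> M" and gd: "flexible g k X"
    by (rule flexible_extension[of g "\<lambda>_. idm" "{x0}"]) (rule g | assumption | simp add: x0)+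
  obtain l Z where l': "\<forall>i. l i \<in> Iso" "agree g' (\<lambda>_. idm) {x0} l"
    and Z: "finite Z" "{x0} \<subseteq> Z" "Z \<subseteq> M" and gd': "flexible g' l Z"
    by (rule flexible_extension[of g' "\<lambda>_. idm" "{x0}"]) (rule g' | assumption | simp add: x0)+
  have k [simp]: "k i \<in> Iso" "l i \<in> Iso" for i using k' l' by auto
  define c where "c = chain g k 4"
  define e where "e = chain g' l 4"
  have ce [simp]: "c \<in> Iso" "e \<in> Iso" by (simp_all add: c_def e_def)
  define P where "P = X \<union> c ` X"
  define Q where "Q = Z \<union> h ` e ` Z"
  have PQ: "finite P" "P \<subseteq> M" "finite Q" "Q \<subseteq> M" using X Z h by (auto simp: P_def Q_def)
  obtain u N where u: "u \<in> M" "0 \<le> N" "\<And>x. x \<in> P \<union> Q \<Longrightarrow> d u x = N"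
    using far_point[of "P \<union> Q" 0] PQ by auto
  \<comment> \<open>As \<open>u\<close> has distance \<open>N\<close> from all points of
    \<open>P\<close> and \<open>Q\<close>, freeness over \<open>u\<close> makes every distance
    between the moved \<open>P\<close> and \<open>Q\<close> exactly \<open>2 * N\<close>.\<close>
  obtain m where m: "fixes_on {u} m" "\<And>x w. x \<in> P \<Longrightarrow> w \<in> Q \<Longrightarrow> via {u} (m x) w"
    by (rule free_set[of "{}" "{u}" Q P]) (use PQ u in auto)
  have mI [simp]: "m \<in> Iso" and mu: "m u = u" using fixes_onD[OF m(1)] by auto
  have far: "d (m p) q = 2 * N" if "p \<in> P" "q \<in> Q" for p q
  proof -
    have M: "p \<in> M" "q \<in> M" using that PQ by auto
    have "d u (m p) = N" using iso_dist[OF mI u(1) M(1)] mu u(3) that by simp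
    moreover have "d (m p) q \<le> d (m p) u + d u q" by (rule triangle) (use M u in auto)
    moreover have "d (m p) u + d u q \<le> d (m p) q" using m(2)[OF that] by (simp add: via_def)
    ultimately show ?thesis using u(3)[of q] that commute[of u "m p"] by simp
  qed
  \<comment> \<open>The moved chain of \<open>g\<close> on one part and \<open>h\<close> after the
    chain of \<open>g'\<close> on the other. Constant cross distances make the union a partial
    isometry.\<close>
  define R where "R = (\<lambda>x. (m x, m (c x))) ` X \<union> (\<lambda>z. (z, h (e z))) ` Z"
  have XM: "x \<in> M" if "x \<in> X" for x using X that by auto
  have ZM: "z \<in> M" if "z \<in> Z" for z using Z that by auto
  obtain \<psi> where \<psi>: "\<psi> \<in> Iso" "\<And>x x'. (x, x') \<in> R \<Longrightarrow> \<psi> x = x'"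
  proof (rule homogeneous_rel[of R])
    show "finite R" using X Z by (simp add: R_def)
    show "R \<subseteq> M \<times> M" using h XM ZM by (auto simp: R_def)
    have f: "d (m x) z = 2 * N" "d z (m x) = 2 * N" "d (m (c x)) (h (e z)) = 2 * N"
      "d (h (e z)) (m (c x)) = 2 * N" if "x \<in> X" "z \<in> Z" for x z
      using far[of x z] far[of "c x" "h (e z)"] that commute[of z] commute[of "h (e z)"]
      by (auto simp: P_def Q_def)
    show "d x' y' = d x y" if "(x, x') \<in> R" "(y, y') \<in> R" for x x' y y'
      using that h XM ZM f unfolding R_def by auto
  qed blast
  have \<psi>X: "\<psi> (m x) = m (c x)" if "x \<in> X" for x using \<psi>(2) that by (auto simp: R_def)
  have \<psi>Z: "\<psi> z = h (e z)" if "z \<in> Z" for z using \<psi>(2) that by (auto simp: R_def)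
  have 1: "iv h \<star> \<psi> \<in> Iso" using h \<psi> by simp
  have 2: "\<forall>z\<in>Z. (iv h \<star> \<psi>) z = chain g' l 4 z"
    using \<psi>Z ZM h \<psi>(1) by (simp add: e_def[symmetric])
  have 3: "finite (m ` X)" "m ` X \<subseteq> M" using X by auto
  obtain l'' where l'': "\<forall>i. l'' i \<in> Iso" "\<forall>x\<in>m ` X. chain g' l'' 4 x = (iv h \<star> \<psi>) x"
    using gd'[unfolded flexible_def, THEN bspec, OF 1, THEN mp, OF 2, THEN spec, THEN mp, OF 3(1),
      THEN mp, OF 3(2)] by (elim exE conjE)
  have gdm: "flexible g (\<lambda>i. m \<star> k i) (m ` X)" by (rule flexible_cj) (use gd X in auto)
  have eq: "\<forall>x\<in>m ` X. chain g (\<lambda>i. m \<star> k i) 4 x = h (chain g' l'' 4 x)"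
  proof
    fix y assume y: "y \<in> m ` X"
    then obtain x where x: "x \<in> X" "y = m x" by blast
    have "chain g (\<lambda>i. m \<star> k i) 4 (m x) = m (c x)"
      unfolding c_def by (rule chain_cj) (use XM[OF x(1)] in auto)
    moreover have "chain g' l'' 4 y = (iv h \<star> \<psi>) y" using l''(2) y by blast
    moreover have "h ((iv h \<star> \<psi>) y) = \<psi> y" using x XM[OF x(1)] h \<psi>(1) by simp
    ultimately show "chain g (\<lambda>i. m \<star> k i) 4 y = h (chain g' l'' 4 y)"
      using \<psi>X[OF x(1)] x by simp
  qed
  show thesis
    by (rule back_and_forth[OF g g' h _ l''(1) 3(1) _ 3(2) gdm eq]) (use X that in auto)
qed

text \<open>With \<open>iv g\<close> as the second isometry, \<open>eight_chain\<close> writes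
  \<open>h\<close> as four conjugates of \<open>g\<close> times the inverse of a product of four
  conjugates of \<open>iv g\<close>, which is a product of four more conjugates of
  \<open>g\<close>.\<close>

lemma eight_conjugates:
  assumes g: "unbounded g" and h: "h \<in> Iso"
  shows "\<exists>cs. length cs = 8 \<and> set cs \<subseteq> conjugates (isometry_group M d) g \<and> h = foldr (\<star>) cs idm"
proof -
  have gI [simp]: "g \<in> Iso" using g by simp
  obtain K L where KL: "\<forall>i. K i \<in> Iso" "\<forall>i. L i \<in> Iso" "chain g K 4 = h \<star> chain (iv g) L 4"
    using eight_chain[OF g unbounded_iv[OF g] h] by blast
  have KI [simp]: "K i \<in> Iso" "L i \<in> Iso" for i using KL by auto
  define a where "a i = cj (K i) g" for i
  define b where "b i = cj (L i) g" for i
  have ab [simp]: "a i \<in> Iso" "b i \<in> Iso" for i by (simp_all add: a_def b_def)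
  have b: "cj (L i) (iv g) = iv (b i)" for i by (simp add: b_def iv_cj)
  have "chain (iv g) L 4 = iv (b 0 \<star> b 1 \<star> b 2 \<star> b 3)"
    by (simp add: chain_4 b isom.inv_mult_group isom.m_assoc)
  then have "chain g K 4 \<star> (b 0 \<star> b 1 \<star> b 2 \<star> b 3) = h"
    using KL(3) h by (simp add: isom.m_assoc)
  moreover have "chain g K 4 = a 3 \<star> a 2 \<star> a 1 \<star> a 0"
    by (simp add: chain_4 a_def[symmetric] isom.m_assoc)
  ultimately have "h = foldr (\<star>) [a 3, a 2, a 1, a 0, b 0, b 1, b 2, b 3] idm"
    by (simp add: isom.m_assoc)
  moreover have "set [a 3, a 2, a 1, a 0, b 0, b 1, b 2, b 3] \<subseteq> conjugates (isometry_group M d) g"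
    by (auto simp: conjugates_def a_def b_def)
  ultimately show ?thesis
    by (intro exI[of _ "[a 3, a 2, a 1, a 0, b 0, b 1, b 2, b 3]"]) simp
qed

text \<open>Needed for the quotient to be nontrivial. The isometry is a limit of a back-and-forth in
  which stage \<open>n\<close> freezes a point that is moved by at least \<open>n\<close>.\<close>

lemma exists_unbounded: obtains f where "unbounded f"
proof -
  obtain z :: "nat \<Rightarrow> 'a" where z: "\<And>n. z n \<in> M" "\<And>x e. x \<in> M \<Longrightarrow> 0 < e \<Longrightarrow> \<exists>n. d x (z n) < e"
    using dense_sequence by blast
  obtain x0 where x0: "x0 \<in> M" using M_nonempty by blast
  define P where "P = (\<lambda>n::nat. \<lambda>(m, X). m \<in> Iso \<and> finite X \<and> X \<noteq> {} \<and> X \<subseteq> M)"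
  define Q where "Q = (\<lambda>n. \<lambda>(m, X) (m', Y). X \<subseteq> Y \<and> (\<forall>x\<in>X. m' x = m x) \<and> z n \<in> Y \<and>
    z n \<in> m' ` Y \<and> (\<exists>u\<in>Y. real n \<le> d u (m' u)))"
  have "\<exists>s. \<forall>n. P n (s n) \<and> Q n (s n) (s (Suc n))"
  proof (rule dependent_nat_choice)
    show "\<exists>s. P 0 s" using x0 by (intro exI[of _ "(idm, {x0})"]) (simp add: P_def)
    fix s n assume "P n s"
    obtain m X where s: "s = (m, X)" by (cases s)
    have p: "m \<in> Iso" "finite X" "X \<noteq> {}" "X \<subseteq> M" using \<open>P n s\<close> by (auto simp: P_def s)
    have mX: "finite (m ` X)" "m ` X \<subseteq> M" "m ` X \<noteq> {}" using p by auto
    obtain u N where u: "u \<in> M" "real n \<le> N" "\<And>x. x \<in> m ` X \<Longrightarrow> d u x = N"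
      using far_point[OF mX(1,2), of "real n"] by blast
    obtain t where t: "fixes_on (m ` X) t" "\<And>x w. x \<in> {m u} \<Longrightarrow> w \<in> {u} \<Longrightarrow> via (m ` X) (t x) w"
      by (rule free_set[of "{}" "m ` X" "{u}" "{m u}"]) (use mX u p in auto)
    have tI: "t \<in> Iso" using t fixes_onD by blast
    define Y where "Y = X \<union> {u, z n, iv (t \<star> m) (z n)}"
    have "real n \<le> d u ((t \<star> m) u)"
    proof -
      obtain x where x: "x \<in> m ` X" "d (t (m u)) x + d x u \<le> d (t (m u)) u"
        using t(2)[of "m u" u] by (auto simp: via_def)
      then have "N \<le> d u (t (m u))"
        using u(3)[OF x(1)] nonneg[of "t (m u)" x] commute[of u x] commute[of u "t (m u)"]
        by linarith
      then show ?thesis using u p(1) tI by simp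
    qed
    moreover have "(t \<star> m) x = m x" if "x \<in> X" for x
    proof -
      have "t (m x) = m x" using fixes_onD(2)[OF t(1)] that by blast
      moreover have "x \<in> M" using that p(4) by blast
      ultimately show ?thesis using p(1) tI by simp
    qed
    moreover have "z n \<in> (t \<star> m) ` Y"
      by (rule image_eqI[of _ _ "iv (t \<star> m) (z n)"])
        (use p(1) tI z(1) in \<open>simp_all add: Y_def iv_app2[of "t \<star> m"] del: mul_app\<close>)
    moreover have "finite Y" "Y \<subseteq> M" using p tI u z(1) iso_in[of "iv (t \<star> m)" "z n"] by (auto simp: Y_def)
    ultimately show "\<exists>y. P (Suc n) y \<and> Q n s y"
      using p tI by (intro exI[of _ "(t \<star> m, Y)"]) (auto simp: P_def Q_def s Y_def)
  qed
  then obtain s where s: "\<And>n. P n (s n)" "\<And>n. Q n (s n) (s (Suc n))" by blast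
  define m where "m n = fst (s n)" for n
  define X where "X n = snd (s n)" for n
  have sn: "s n = (m n, X n)" for n by (simp add: m_def X_def)
  have p: "m n \<in> Iso" "X n \<subseteq> M" for n using s(1)[of n] by (auto simp: sn P_def)
  have q: "X n \<subseteq> X (Suc n)" "x \<in> X n \<Longrightarrow> m (Suc n) x = m n x" "z n \<in> X (Suc n)"
    "z n \<in> m (Suc n) ` X (Suc n)" "\<exists>u\<in>X (Suc n). real n \<le> d u (m (Suc n) u)" for n x
    using s(2)[of n] by (auto simp: sn Q_def)
  obtain l where l: "l \<in> Iso" "\<And>n x. x \<in> X n \<Longrightarrow> l x = m n x"
  proof (rule iso_limit[of m X])
    fix x and e :: real assume "x \<in> M" "0 < e"
    then obtain n where n: "d x (z n) < e" using z by blast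
    then show "\<exists>n. \<exists>y\<in>X n. d x y < e" using q(3) by blast
    show "\<exists>n. \<exists>y\<in>X n. d x (m n y) < e" using q(4)[of n] n by force
  qed (use p q in blast)+
  have "\<exists>u\<in>M. N \<le> d u (l u)" for N
  proof -
    obtain n where n: "N \<le> real n" using real_arch_simple by blast
    obtain u where u: "u \<in> X (Suc n)" "real n \<le> d u (m (Suc n) u)" using q(5) by blast
    then have "N \<le> d u (l u)" using l(2)[OF u(1)] n by simp
    then show ?thesis using u p(2) by blast
  qed
  then have "unbounded l" using l(1) by (simp add: unbounded_def jointly_unbounded_def)
  then show thesis by (rule that)
qed

subsection \<open>Bounded and unbounded isometries\<close>

lemma bounded_isometries_iff:
  "f \<in> bounded_isometries M d \<longleftrightarrow> f \<in> Iso \<and> (\<exists>N. \<forall>x\<in>M. d x (f x) \<le> N)"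
  by (auto simp: bounded_isometries_def bdd_above_def)

lemma unbounded_iff: "unbounded f \<longleftrightarrow> f \<in> Iso - bounded_isometries M d"
proof -
  \<comment> \<open>Negating boundedness produces strict inequalities, while
    \<open>unbounded\<close> is stated with weak ones.\<close>
  have "(\<forall>N. \<exists>x\<in>M. N \<le> d x (f x)) \<longleftrightarrow> (\<forall>N. \<exists>x\<in>M. N < d x (f x))"
    by (meson gt_ex less_imp_le order_less_le_trans)
  then show ?thesis
    by (auto simp: unbounded_def jointly_unbounded_def bounded_isometries_iff not_le)
qed

lemma normal_bounded_isometries: "bounded_isometries M d \<lhd> isometry_group M d"
  unfolding isom.normal_inv_iff
proof (intro conjI ballI)
  show "subgroup (bounded_isometries M d) (isometry_group M d)"
  proof (rule isom.subgroupI)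
    show "bounded_isometries M d \<subseteq> Iso" by (auto simp: bounded_isometries_iff)
    have "idm \<in> bounded_isometries M d"
      by (auto simp: bounded_isometries_iff intro!: exI[of _ 0])
    then show "bounded_isometries M d \<noteq> {}" by blast
  next
    fix f assume "f \<in> bounded_isometries M d"
    then obtain N where f: "f \<in> Iso" "\<forall>x\<in>M. d x (f x) \<le> N" by (auto simp: bounded_isometries_iff)
    have "d x (iv f x) \<le> N" if "x \<in> M" for x
      using f(2)[THEN bspec, of "iv f x"] f(1) that commute[of x] by simp
    then show "iv f \<in> bounded_isometries M d" using f by (auto simp: bounded_isometries_iff)
  next
    fix f g assume "f \<in> bounded_isometries M d" "g \<in> bounded_isometries M d"
    then obtain N N' where f: "f \<in> Iso" "\<forall>x\<in>M. d x (f x) \<le> N" and g: "g \<in> Iso" "\<forall>x\<in>M. d x (g x) \<le> N'"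
      by (auto simp: bounded_isometries_iff)
    have "d x ((f \<star> g) x) \<le> N' + N" if "x \<in> M" for x
    proof -
      have "d x (f (g x)) \<le> d x (g x) + d (g x) (f (g x))"
        by (rule triangle) (use f g that in auto)
      also have "\<dots> \<le> N' + N" using f g that by (intro add_mono) auto
      finally show ?thesis using f g that by simp
    qed
    then show "f \<star> g \<in> bounded_isometries M d" using f g by (auto simp: bounded_isometries_iff)
  qed
next
  fix k f assume k: "k \<in> Iso" and "f \<in> bounded_isometries M d"
  then obtain N where f: "f \<in> Iso" "\<forall>x\<in>M. d x (f x) \<le> N" by (auto simp: bounded_isometries_iff)
  have "d x (cj k f x) \<le> N" if "x \<in> M" for x
  proof -
    have "d x (cj k f x) = d (iv k x) (f (iv k x))"
      using iso_dist_iv2[OF k that, of "f (iv k x)"] f(1) k that by simp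
    then show ?thesis using f(2) k that by simp
  qed
  then show "cj k f \<in> bounded_isometries M d" using k f by (auto simp: bounded_isometries_iff)
qed

lemma normal_closure_unbounded:
  assumes g: "unbounded g"
  shows "normal_closure (isometry_group M d) {g} = Iso"
proof
  show "normal_closure (isometry_group M d) {g} \<subseteq> Iso"
  proof -
    have "Iso \<lhd> isometry_group M d" using isom.normal_invI[OF isom.subgroup_self] by simp
    then show ?thesis using unbounded_iso[OF g] unfolding normal_closure_def by blast
  qed
  show "Iso \<subseteq> normal_closure (isometry_group M d) {g}"
    unfolding normal_closure_def
  proof (intro subsetI InterI)
    fix h N assume h: "h \<in> Iso" and "N \<in> {N. N \<lhd> isometry_group M d \<and> {g} \<subseteq> N}"
    then interpret N: normal N "isometry_group M d" by simp
    have gN: "g \<in> N" using \<open>N \<in> _\<close> by simp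
    obtain cs where cs: "set cs \<subseteq> conjugates (isometry_group M d) g" "h = foldr (\<star>) cs idm"
      using eight_conjugates[OF g h] by blast
    have "conjugates (isometry_group M d) g \<subseteq> N"
      using gN by (auto simp: conjugates_def N.inv_op_closed2)
    then have "set cs \<subseteq> N" using cs by blast
    then show "h \<in> N" unfolding cs(2) by (induction cs) auto
  qed
qed

end

theorem theorem2p12:
  fixes U :: "'a set" and d :: "'a \<Rightarrow> 'a \<Rightarrow> real"
  assumes "urysohn_space U d"
  defines "G \<equiv> isometry_group U d"
    and "B \<equiv> bounded_isometries U d"
  shows "B \<lhd> G \<and>
    (\<forall>g \<in> carrier G - B. normal_closure G {g} = carrier G) \<and>
    (\<forall>g \<in> carrier G - B. \<forall>h \<in> carrier G.
      \<exists>cs. length cs = 8 \<and> set cs \<subseteq> conjugates G g \<and>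
           h = foldr (\<lambda>x y. x \<otimes>\<^bsub>G\<^esub> y) cs \<one>\<^bsub>G\<^esub>) \<and>
    is_simple_grp (G Mod B)"
proof -
  interpret urysohn_space U d by fact
  have car: "carrier G = isometries U d" by (simp add: G_def)
  have ub: "unbounded g" if "g \<in> carrier G - B" for g
    using that unbounded_iff by (simp add: car B_def)
  have normal: "B \<lhd> G" unfolding B_def G_def by (rule normal_bounded_isometries)
  have closure: "normal_closure G {g} = carrier G" if "g \<in> carrier G - B" for g
    unfolding car unfolding G_def by (rule normal_closure_unbounded[OF ub[OF that]])
  have "B \<noteq> carrier G"
    using exists_unbounded unbounded_iff by (auto simp: car B_def)
  then have "is_simple_grp (G Mod B)" using is_simple_grp_Mod normal closure by blast
  moreover have "\<exists>cs. length cs = 8 \<and> set cs \<subseteq> conjugates G g \<and>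
      h = foldr (\<lambda>x y. x \<otimes>\<^bsub>G\<^esub> y) cs \<one>\<^bsub>G\<^esub>" if "g \<in> carrier G - B" "h \<in> carrier G" for g h
    using eight_conjugates[OF ub[OF that(1)], of h] that(2) unfolding car unfolding G_def .
  ultimately show ?thesis using normal closure by blast
qed

end
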